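(* Fix an integer $k>0$. The sequence $\left(\#(SL_k(\mathbb{Z}/n\mathbb{Z}))\right)_{n\in\mathbb{N}}$ is Ces\`aro equivalent as $n\to\infty$ to the sequence $\left(C_1(k)\,n^{k^2-1}\right)_{n\in\mathbb{N}}$, and the sequence $\left(\#(GL_k(\mathbb{Z}/n\mathbb{Z}))\right)_{n\in\mathbb{N}}$ is Ces\`aro equivalent as $n\to\infty$ to $\left(C_2(k)\,n^{k^2}\right)_{n\in\mathbb{N}}$, where $C_1(1)=1$, $C_2(1)=\prod_p\left(1-\frac{1}{p^2}\right)$, and for every $k>1$ $$C_1(k)=\prod_p\left(1-\frac{1}{p}\left(1-\prod_{i=2}^k\left(1-\frac{1}{p^i}\right)\right)\right),\qquad C_2(k)=\prod_p\left(1-\frac{1}{p}\left(1-\prod_{i=1}^k\left(1-\frac{1}{p^i}\right)\right)\right).$$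
   Context: $\#(X)$ denotes the cardinality of a finite set $X$; $\prod_p$ denotes the product over all prime numbers. Two sequences of real numbers $(x_n)_{n\in\mathbb{N}}$ and $(y_n)_{n\in\mathbb{N}}$ are called Ces\`aro equivalent if $\lim_{n\to\infty}\frac{x_1+\cdots+x_n}{y_1+\cdots+y_n}=1$. *)

theory Defs
  imports
    "HOL-Algebra.IntRing"
    "HOL-Combinatorics.Permutations"
    "HOL-Analysis.Infinite_Products"
    "HOL-Computational_Algebra.Primes"
    "Jordan_Normal_Form.Matrix"
begin

text \<open>
  The ring structure on matrices in the library is tied to type classes, whereas here the
  coefficient ring is the quotient \<open>ZFact (int n)\<close> of the integers by \<open>n\<close>, with \<open>n\<close>
  varying. The operations are therefore stated relative to a ring record \<open>R\<close>; only the matrix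
  type itself is taken from the library.
\<close>

definition mat_monoid :: "nat \<Rightarrow> ('a, 'b) ring_scheme \<Rightarrow> 'a mat monoid" where
  "mat_monoid k R =
    \<lparr>carrier = {A \<in> carrier_mat k k. elements_mat A \<subseteq> carrier R},
     monoid.mult = (\<lambda>A B. mat k k (\<lambda>(i, j). \<Oplus>\<^bsub>R\<^esub>l\<in>{0..<k}. A $$ (i, l) \<otimes>\<^bsub>R\<^esub> B $$ (l, j))),
     one = mat k k (\<lambda>(i, j). if i = j then \<one>\<^bsub>R\<^esub> else \<zero>\<^bsub>R\<^esub>)\<rparr>"

definition ring_det :: "nat \<Rightarrow> ('a, 'b) ring_scheme \<Rightarrow> 'a mat \<Rightarrow> 'a" where
  "ring_det k R A =
    (\<Oplus>\<^bsub>R\<^esub>\<sigma>\<in>{\<sigma>. \<sigma> permutes {0..<k}}.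
      (if evenperm \<sigma> then \<one>\<^bsub>R\<^esub> else \<ominus>\<^bsub>R\<^esub> \<one>\<^bsub>R\<^esub>) \<otimes>\<^bsub>R\<^esub>
      (\<Otimes>\<^bsub>R\<^esub>i\<in>{0..<k}. A $$ (i, \<sigma> i)))"

definition GL :: "nat \<Rightarrow> ('a, 'b) ring_scheme \<Rightarrow> 'a mat set" where
  "GL k R = Units (mat_monoid k R)"

definition SL :: "nat \<Rightarrow> ('a, 'b) ring_scheme \<Rightarrow> 'a mat set" where
  "SL k R = {A \<in> carrier (mat_monoid k R). ring_det k R A = \<one>\<^bsub>R\<^esub>}"

text \<open>Sequences are indexed from 1; the value at 0 is ignored.\<close>

definition cesaro_equivalent :: "(nat \<Rightarrow> real) \<Rightarrow> (nat \<Rightarrow> real) \<Rightarrow> bool" where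
  "cesaro_equivalent x y \<longleftrightarrow>
    (\<lambda>n. (\<Sum>i=1..n. x i) / (\<Sum>i=1..n. y i)) \<longlonglongrightarrow> 1"

definition prime_prod :: "(nat \<Rightarrow> real) \<Rightarrow> real" where
  "prime_prod f = (\<Prod>p. if prime p then f p else 1)"

definition C1 :: "nat \<Rightarrow> real" where
  "C1 k =
    (if k = 1 then 1
     else prime_prod (\<lambda>p. 1 - 1 / real p * (1 - (\<Prod>i=2..k. 1 - 1 / real p ^ i))))"

definition C2 :: "nat \<Rightarrow> real" where
  "C2 k =
    (if k = 1 then prime_prod (\<lambda>p. 1 - 1 / real p ^ 2)
     else prime_prod (\<lambda>p. 1 - 1 / real p * (1 - (\<Prod>i=1..k. 1 - 1 / real p ^ i))))"

end

theory Submission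
  imports
    Defs
    "HOL-Number_Theory.Totient"
    "Jordan_Normal_Form.Determinant"
begin

text \<open>
  Counting: sort the matrices over \<open>\<int>/n\<close> of a given unit determinant by their first column, which
  must be unimodular. Elementary row operations show that every unimodular column occurs equally
  often, and the matrices with first column \<open>e\<^sub>1\<close> consist of an arbitrary top row and a smaller matrix
  of the same determinant. Hence both cardinalities have the form \<open>n\<^sup>a \<Prod>\<^bsub>p | n\<^esub> g p\<close> with
  \<open>1 - g p = O(1/p)\<close>, and no Chinese remainder theorem is needed.

  Averaging: if only the primes up to \<open>P\<close> are kept, \<open>\<Prod>\<^bsub>p | n\<^esub> g p\<close> expands into finitely many
  indicators of \<open>d | n\<close>, each of mean \<open>1/d\<close>, so its mean is the partial Euler product. The
  discarded primes change the mean by at most \<open>O(\<Sum>\<^bsub>p > P\<^esub> 1/p\<^sup>2) = O(1/P)\<close>, uniformly in the length of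
  the average, so the two limits may be exchanged.
\<close>

section \<open>Mean values of products over the prime divisors\<close>

text \<open>Mean value bounds for \<open>x ^ Suc a\<close> over a unit interval. The induction
  splits off a factor \<open>x\<close> for the lower bound and \<open>x + 1\<close> for the upper
  one.\<close>

lemma power_Suc_diff_bounds:
  fixes x :: real
  assumes "x \<ge> 0"
  shows "real (Suc a) * x ^ a \<le> (x + 1) ^ Suc a - x ^ Suc a"
    and "(x + 1) ^ Suc a - x ^ Suc a \<le> real (Suc a) * (x + 1) ^ a"
proof (induction a)
  case (Suc a)
  {
    case 1
    have "x * (real (Suc a) * x ^ a) \<le> x * ((x + 1) ^ Suc a - x ^ Suc a)"
      using Suc(1) assms by (intro mult_left_mono)
    moreover have "x ^ Suc a \<le> (x + 1) ^ Suc a"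
      using assms by (intro power_mono) auto
    ultimately show ?case
      by (simp add: algebra_simps)
  next
    case 2
    have "(x + 1) * ((x + 1) ^ Suc a - x ^ Suc a) \<le> (x + 1) * (real (Suc a) * (x + 1) ^ a)"
      using Suc(2) assms by (intro mult_left_mono) auto
    moreover have "x ^ Suc a \<le> (x + 1) ^ Suc a"
      using assms by (intro power_mono) auto
    ultimately show ?case
      by (simp add: algebra_simps)
  }
qed simp_all

text \<open>The preceding bounds telescope, which amounts to comparing the sum with the integral of
  \<open>x ^ a\<close>.\<close>

lemma sum_powers_bounds:
  shows "real N ^ Suc a \<le> real (Suc a) * (\<Sum>n=1..N. real n ^ a)"
    and "real (Suc a) * (\<Sum>n=1..N. real n ^ a) \<le> real (Suc N) ^ Suc a"
proof (induction N)
  case (Suc N)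
  {
    case 1
    show ?case
      using Suc(1) power_Suc_diff_bounds(2)[of "real N" a]
      by (simp add: distrib_left add.commute)
  next
    case 2
    show ?case
      using Suc(2) power_Suc_diff_bounds(1)[of "real (Suc N)" a]
      by (simp add: distrib_left add.commute)
  }
qed simp_all

lemma sum_powers_pos: "N > 0 \<Longrightarrow> (\<Sum>n=1..N. real n ^ a) > 0"
  by (intro sum_pos) auto

lemma sum_powers_asymp:
  "(\<lambda>N. (\<Sum>n=1..N. real n ^ a) / real N ^ Suc a) \<longlonglongrightarrow> 1 / real (Suc a)"
proof (rule tendsto_sandwich)
  have ev: "eventually (\<lambda>N::nat. N > 0) sequentially"
    by (rule eventually_gt_at_top)
  show "eventually (\<lambda>N. 1 / real (Suc a) \<le> (\<Sum>n=1..N. real n ^ a) / real N ^ Suc a) sequentially"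
    using ev
  proof eventually_elim
    case (elim N)
    with sum_powers_bounds(1)[where N = N and a = a] show ?case
      by (simp add: pos_divide_le_eq pos_le_divide_eq mult.commute[of _ "real (Suc a)"] del: power_Suc of_nat_Suc)
  qed
  show "eventually (\<lambda>N. (\<Sum>n=1..N. real n ^ a) / real N ^ Suc a
          \<le> 1 / real (Suc a) * (real (Suc N) / real N) ^ Suc a) sequentially"
    using ev
  proof eventually_elim
    case (elim N)
    with sum_powers_bounds(2)[where N = N and a = a] show ?case
      by (simp add: power_divide pos_divide_le_eq pos_le_divide_eq mult.commute del: power_Suc of_nat_Suc)
  qed
  have "(\<lambda>N. 1 / real (Suc a) * (real (Suc N) / real N) ^ Suc a) \<longlonglongrightarrow> 1 / real (Suc a) * 1 ^ Suc a"
    by (intro tendsto_intros LIMSEQ_Suc_n_over_n)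
  then show "(\<lambda>N. 1 / real (Suc a) * (real (Suc N) / real N) ^ Suc a) \<longlonglongrightarrow> 1 / real (Suc a)"
    by simp
qed simp

lemma sum_powers_multiples:
  assumes "d > 0"
  shows "(\<Sum>n | n \<in> {1..N} \<and> d dvd n. real n ^ a) = real d ^ a * (\<Sum>n=1..N div d. real n ^ a)"
proof -
  have "(\<Sum>n | n \<in> {1..N} \<and> d dvd n. real n ^ a) = (\<Sum>m=1..N div d. real (d * m) ^ a)"
    using assms
    by (intro sum.reindex_bij_witness[where i = "\<lambda>m. d * m" and j = "\<lambda>n. n div d"])
       (auto simp: div_le_mono less_eq_div_iff_mult_less_eq mult.commute div_greater_zero_iff
          dvd_imp_le Suc_le_eq)
  then show ?thesis
    by (simp add: power_mult_distrib sum_distrib_left)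
qed

text \<open>The density \<open>1 / d\<close> is only asymptotic. Giving away the factor
  \<open>Suc a\<close> yields a bound uniform in \<open>N\<close> and \<open>d\<close>, as the
  truncation error requires; it rests on the trivial estimate of a power sum by its largest
  term.\<close>

lemma sum_powers_multiples_le:
  assumes "d > 0"
  shows "(\<Sum>n | n \<in> {1..N} \<and> d dvd n. real n ^ a) \<le> real (Suc a) / real d * (\<Sum>n=1..N. real n ^ a)"
proof -
  have "(\<Sum>n=1..M. real n ^ a) \<le> real M ^ Suc a" for M
  proof -
    have "(\<Sum>n=1..M. real n ^ a) \<le> (\<Sum>n=1..M. real M ^ a)"
      by (intro sum_mono power_mono) auto
    then show ?thesis by simp
  qed
  then have "real d ^ a * (\<Sum>n=1..N div d. real n ^ a) \<le> real d ^ a * real (N div d) ^ Suc a"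
    by (intro mult_left_mono) auto
  also have "\<dots> \<le> real d ^ a * (real N / real d) ^ Suc a"
    by (intro mult_left_mono power_mono of_nat_div_le_of_nat) auto
  also have "\<dots> = real N ^ Suc a / real d"
    using assms by (simp add: field_simps)
  also have "\<dots> \<le> real (Suc a) * (\<Sum>n=1..N. real n ^ a) / real d"
    by (intro divide_right_mono sum_powers_bounds) auto
  finally show ?thesis
    using sum_powers_multiples[OF assms] by simp
qed

lemma LIMSEQ_div_over:
  assumes "d > 0"
  shows "(\<lambda>N. real (N div d) / real N) \<longlonglongrightarrow> 1 / real d"
proof (rule tendsto_sandwich)
  have ev: "eventually (\<lambda>N::nat. N > 0) sequentially"
    by (rule eventually_gt_at_top)
  show "eventually (\<lambda>N. 1 / real d - 1 / real N \<le> real (N div d) / real N) sequentially"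
    using ev
  proof eventually_elim
    case (elim N)
    have "real N \<le> real (d * (N div d) + d)"
      using mult_div_mod_eq[of d N] mod_less_divisor[OF assms, of N]
      by (intro of_nat_mono) linarith
    then have "real N / real d - real (N div d) \<le> 1"
      using assms by (simp add: field_simps)
    then have "(real N / real d - 1) / real N \<le> real (N div d) / real N"
      by (intro divide_right_mono) auto
    then show ?case using elim by (simp add: diff_divide_distrib)
  qed
  show "eventually (\<lambda>N. real (N div d) / real N \<le> 1 / real d) sequentially"
    using ev
  proof eventually_elim
    case (elim N)
    have "real (N div d) / real N \<le> (real N / real d) / real N"
      by (intro divide_right_mono of_nat_div_le_of_nat) auto
    then show ?case using elim by simp
  qed
  have "(\<lambda>N. 1 / real d - 1 / real N) \<longlonglongrightarrow> 1 / real d - 0"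
    by (intro tendsto_intros lim_1_over_n)
  then show "(\<lambda>N. 1 / real d - 1 / real N) \<longlonglongrightarrow> 1 / real d" by simp
qed simp

text \<open>Both power sums are normalised to \<open>r\<close>, whose limit cancels; what is left is
  \<open>d ^ a\<close> times the \<open>Suc a\<close>-th power of \<open>1 / d\<close>.\<close>

lemma sum_powers_multiples_ratio:
  assumes "d > 0"
  shows "(\<lambda>N. (\<Sum>n | n \<in> {1..N} \<and> d dvd n. real n ^ a) / (\<Sum>n=1..N. real n ^ a)) \<longlonglongrightarrow> 1 / real d"
proof -
  define W where "W N = (\<Sum>n=1..N. real n ^ a)" for N
  define r where "r N = W N / real N ^ Suc a" for N
  have r: "r \<longlonglongrightarrow> 1 / real (Suc a)"
    unfolding r_def W_def by (rule sum_powers_asymp)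
  have div: "filterlim (\<lambda>N. N div d) at_top sequentially"
    unfolding filterlim_at_top
  proof
    fix Z
    show "eventually (\<lambda>N. Z \<le> N div d) sequentially"
      using eventually_ge_at_top[of "Z * d"]
      by eventually_elim (use assms in \<open>simp add: less_eq_div_iff_mult_less_eq\<close>)
  qed
  have "(\<lambda>N. real d ^ a * (r (N div d) * (real (N div d) / real N) ^ Suc a / r N))
          \<longlonglongrightarrow> real d ^ a * (1 / real (Suc a) * (1 / real d) ^ Suc a / (1 / real (Suc a)))"
    by (intro tendsto_intros LIMSEQ_div_over assms r filterlim_compose[OF r div]) auto
  also have "real d ^ a * (1 / real (Suc a) * (1 / real d) ^ Suc a / (1 / real (Suc a))) = 1 / real d"
  proof -
    have "real d ^ a * (1 / real (Suc a) * (1 / real d) ^ Suc a / (1 / real (Suc a)))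
        = real d ^ a * (1 / real d) ^ Suc a * (real (Suc a) / real (Suc a))"
      by (simp only: divide_simps) simp
    also have "\<dots> = 1 / real d"
      using assms by (simp add: power_divide)
    finally show ?thesis .
  qed
  finally show ?thesis
  proof (rule Lim_transform_eventually)
    show "eventually (\<lambda>N. real d ^ a * (r (N div d) * (real (N div d) / real N) ^ Suc a / r N)
        = (\<Sum>n | n \<in> {1..N} \<and> d dvd n. real n ^ a) / (\<Sum>n=1..N. real n ^ a)) sequentially"
      \<comment> \<open>From \<open>N = d\<close> on, \<open>N div d\<close> is positive and the
        normalisation divides by nonzero numbers.\<close>
      using eventually_ge_at_top[of d]
    proof eventually_elim
      case (elim N)
      then have "N > 0" "N div d > 0" using assms by (auto simp: div_greater_zero_iff)
      then have "real d ^ a * (r (N div d) * (real (N div d) / real N) ^ Suc a / r N)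
          = real d ^ a * W (N div d) / W N"
        by (simp add: r_def power_divide del: power_Suc)
      then show ?case
        unfolding W_def using sum_powers_multiples[OF assms] by simp
    qed
  qed
qed

text \<open>Telescoping with \<open>1 / (M + 1)^2 \<le> 1 / M - 1 / (M + 1)\<close>. Summing over
  all integers is affordable, since the tail over the primes only has to vanish.\<close>

lemma sum_inverse_squares_le:
  assumes "Q > 0"
  shows "(\<Sum>p=Suc Q..N. 1 / real p ^ 2) \<le> 1 / real Q"
proof (cases "Q \<le> N")
  case True
  then have "(\<Sum>p=Suc Q..N. 1 / real p ^ 2) \<le> 1 / real Q - 1 / real N"
  proof (induction rule: dec_induct)
    case (step M)
    have "1 / real (Suc M) ^ 2 \<le> 1 / (real M * real (Suc M))"
      using step.hyps assms unfolding power2_eq_square by (intro divide_left_mono mult_right_mono) auto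
    also have "\<dots> = 1 / real M - 1 / real (Suc M)"
      using step.hyps assms by (simp add: field_simps)
    finally have "1 / real (Suc M) ^ 2 \<le> 1 / real M - 1 / real (Suc M)" .
    then show ?case using step by simp
  qed simp
  also have "\<dots> \<le> 1 / real Q" by simp
  finally show ?thesis .
qed simp

section \<open>Divisibility indicators and truncated mean values\<close>

text \<open>Expanding the product selects a set \<open>T\<close> of primes; distinct primes being
  coprime, \<open>\<Prod>T\<close> divides \<open>n\<close> exactly if each member does. The lemma
  serves twice: for mean values with \<open>c p = g p - 1\<close>, and with \<open>c p = - 1\<close>
  as inclusion-exclusion for columns.\<close>

lemma prod_indicator_dvd_expansion:
  fixes c :: "nat \<Rightarrow> real"
  assumes "finite S" "\<And>p. p \<in> S \<Longrightarrow> prime p"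
  shows "(\<Prod>p\<in>S. 1 + c p * of_bool (p dvd n)) = (\<Sum>T\<in>Pow S. (\<Prod>p\<in>T. c p) * of_bool (\<Prod>T dvd n))"
proof -
  have "(\<Prod>p\<in>S. 1 + c p * of_bool (p dvd n)) = (\<Sum>T\<in>Pow S. (\<Prod>p\<in>T. c p * of_bool (p dvd n)) * (\<Prod>p\<in>S - T. 1))"
    using assms(1) by (subst add.commute, intro prod_add)
  also have "\<dots> = (\<Sum>T\<in>Pow S. (\<Prod>p\<in>T. c p) * of_bool (\<Prod>T dvd n))"
  proof (intro sum.cong refl)
    fix T assume T: "T \<in> Pow S"
    then have fin: "finite T" using assms(1) finite_subset by auto
    have "\<Prod>T dvd n \<longleftrightarrow> (\<forall>p\<in>T. p dvd n)"
    proof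
      assume dvd: "\<forall>p\<in>T. p dvd n"
      have cop: "pairwise coprime T"
        using T assms(2) primes_coprime unfolding pairwise_def by blast
      from fin cop dvd show "\<Prod>T dvd n"
        by (induction T rule: finite_induct) (auto simp: pairwise_insert intro!: divides_mult prod_coprime_right)
    next
      assume "\<Prod>T dvd n"
      then show "\<forall>p\<in>T. p dvd n"
        using fin by (meson dvd_prodI dvd_trans)
    qed
    moreover have "(\<Prod>p\<in>T. of_bool (p dvd n)) = (of_bool (\<forall>p\<in>T. p dvd n) :: real)"
      using fin by (induction T) auto
    ultimately show "(\<Prod>p\<in>T. c p * of_bool (p dvd n)) * (\<Prod>p\<in>S - T. 1) = (\<Prod>p\<in>T. c p) * of_bool (\<Prod>T dvd n)"
      by (simp add: prod.distrib)
  qed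
  finally show ?thesis .
qed

text \<open>Only finitely many divisors occur, so the limit is taken term by term; replacing each
  indicator by its density \<open>1 / \<Prod>T\<close> gives an expansion that refolds into a
  product.\<close>

lemma truncated_mean_value:
  fixes c :: "nat \<Rightarrow> real"
  assumes S: "finite S" "\<And>p. p \<in> S \<Longrightarrow> prime p"
  shows "(\<lambda>N. (\<Sum>n=1..N. real n ^ a * (\<Prod>p\<in>S. 1 + c p * of_bool (p dvd n))) / (\<Sum>n=1..N. real n ^ a))
           \<longlonglongrightarrow> (\<Prod>p\<in>S. 1 + c p / real p)"
proof -
  have "(\<lambda>N. \<Sum>T\<in>Pow S. (\<Prod>p\<in>T. c p) *
          ((\<Sum>n | n \<in> {1..N} \<and> \<Prod>T dvd n. real n ^ a) / (\<Sum>n=1..N. real n ^ a)))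
         \<longlonglongrightarrow> (\<Sum>T\<in>Pow S. (\<Prod>p\<in>T. c p) * (1 / real (\<Prod>T)))"
  proof (intro tendsto_sum tendsto_mult tendsto_const sum_powers_multiples_ratio)
    fix T assume "T \<in> Pow S"
    then show "0 < \<Prod>T"
      using S(2) by (intro prod_pos) (auto dest: prime_gt_0_nat)
  qed
  also have "(\<Sum>T\<in>Pow S. (\<Prod>p\<in>T. c p) * (1 / real (\<Prod>T))) = (\<Sum>T\<in>Pow S. (\<Prod>p\<in>T. c p / real p) * (\<Prod>p\<in>S - T. 1))"
    by (simp add: prod_dividef)
  also have "\<dots> = (\<Prod>p\<in>S. c p / real p + 1)"
    using S(1) by (rule prod_add[symmetric])
  also have "(\<lambda>N. \<Sum>T\<in>Pow S. (\<Prod>p\<in>T. c p) *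
          ((\<Sum>n | n \<in> {1..N} \<and> \<Prod>T dvd n. real n ^ a) / (\<Sum>n=1..N. real n ^ a)))
        = (\<lambda>N. (\<Sum>n=1..N. real n ^ a * (\<Prod>p\<in>S. 1 + c p * of_bool (p dvd n))) / (\<Sum>n=1..N. real n ^ a))"
  proof
    fix N
    have "(\<Sum>n=1..N. real n ^ a * (\<Prod>p\<in>S. 1 + c p * of_bool (p dvd n)))
        = (\<Sum>n=1..N. \<Sum>T\<in>Pow S. (\<Prod>p\<in>T. c p) * (real n ^ a * of_bool (\<Prod>T dvd n)))"
      by (simp only: prod_indicator_dvd_expansion[OF S] sum_distrib_left mult_ac)
    also have "\<dots> = (\<Sum>T\<in>Pow S. (\<Prod>p\<in>T. c p) * (\<Sum>n=1..N. real n ^ a * of_bool (\<Prod>T dvd n)))"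
      by (subst sum.swap) (simp only: sum_distrib_left)
    also have "\<dots> = (\<Sum>T\<in>Pow S. (\<Prod>p\<in>T. c p) * (\<Sum>n | n \<in> {1..N} \<and> \<Prod>T dvd n. real n ^ a))"
      by (simp add: sum.inter_filter[symmetric] of_bool_def if_distrib cong: if_cong)
    finally show "(\<Sum>T\<in>Pow S. (\<Prod>p\<in>T. c p) *
          ((\<Sum>n | n \<in> {1..N} \<and> \<Prod>T dvd n. real n ^ a) / (\<Sum>n=1..N. real n ^ a)))
        = (\<Sum>n=1..N. real n ^ a * (\<Prod>p\<in>S. 1 + c p * of_bool (p dvd n))) / (\<Sum>n=1..N. real n ^ a)"
      by (simp only: sum_divide_distrib[of _ "Pow S"] times_divide_eq_right)
  qed
  finally show ?thesis by (simp add: add.commute)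
qed


section \<open>Euler products and the removal of the truncation\<close>

text \<open>A factor differs from 1 by at most \<open>\<bar>K\<bar> / p^2\<close>, hence absolute
  convergence. Positivity is recorded because the Cesaro quotient divides by the product.\<close>

lemma prime_prod_tendsto:
  fixes g :: "nat \<Rightarrow> real"
  assumes g: "\<And>p. prime p \<Longrightarrow> 0 \<le> g p" "\<And>p. prime p \<Longrightarrow> g p \<le> 1"
    and K: "\<And>p. prime p \<Longrightarrow> 1 - g p \<le> K / real p"
  shows "(\<lambda>P. \<Prod>p | p \<in> {..P} \<and> prime p. 1 - 1 / real p * (1 - g p))
           \<longlonglongrightarrow> prime_prod (\<lambda>p. 1 - 1 / real p * (1 - g p))"
    and "prime_prod (\<lambda>p. 1 - 1 / real p * (1 - g p)) > 0"
proof -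
  define f where "f p = (if prime p then 1 - 1 / real p * (1 - g p) else 1)" for p :: nat
  have "summable (\<lambda>p. norm (f p - 1))"
  proof (rule summable_comparison_test')
    show "summable (\<lambda>p. \<bar>K\<bar> * inverse (real p ^ 2))"
      by (intro summable_mult inverse_power_summable) auto
    fix p :: nat
    show "norm (norm (f p - 1)) \<le> \<bar>K\<bar> * inverse (real p ^ 2)"
    proof (cases "prime p")
      case True
      have "f p - 1 = - (1 / real p * (1 - g p))"
        using True by (simp add: f_def)
      then have "norm (f p - 1) = 1 / real p * (1 - g p)"
        using g(2)[OF True] by (simp only: real_norm_def abs_minus_cancel) (rule abs_of_nonneg, simp)
      also have "1 - g p \<le> \<bar>K\<bar> / real p"
        using K[OF True] divide_right_mono[of K "\<bar>K\<bar>" "real p"] by linarith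
      then have "1 / real p * (1 - g p) \<le> 1 / real p * (\<bar>K\<bar> / real p)"
        by (intro mult_left_mono) auto
      also have "\<dots> = \<bar>K\<bar> * inverse (real p ^ 2)"
        by (simp add: power2_eq_square inverse_eq_divide)
      finally show ?thesis by simp
    qed (simp add: f_def)
  qed
  then have conv: "convergent_prod f"
    by (intro abs_convergent_prod_imp_convergent_prod) (simp add: abs_convergent_prod_conv_summable)
  have pp: "prime_prod (\<lambda>p. 1 - 1 / real p * (1 - g p)) = prodinf f"
    by (simp only: prime_prod_def f_def[abs_def])
  show "(\<lambda>P. \<Prod>p | p \<in> {..P} \<and> prime p. 1 - 1 / real p * (1 - g p))
           \<longlonglongrightarrow> prime_prod (\<lambda>p. 1 - 1 / real p * (1 - g p))"
    unfolding pp using convergent_prod_LIMSEQ[OF conv]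
    by (subst prod.inter_filter) (simp_all add: f_def)
  \<comment> \<open>At a prime, \<open>1 - g p \<le> 1\<close> and \<open>p \<ge> 2\<close> make the
    factor at least one half.\<close>
  have "f p > 0" for p
  proof (cases "prime p")
    case True
    then have "1 / real p * (1 - g p) \<le> 1 / 2 * 1"
      using g[OF True] prime_ge_2_nat[OF True] by (intro mult_mono divide_left_mono) auto
    then show ?thesis using True by (simp only: f_def if_True)
  qed (simp add: f_def)
  with conv show "prime_prod (\<lambda>p. 1 - 1 / real p * (1 - g p)) > 0"
    unfolding pp by (rule less_0_prodinf)
qed

text \<open>All prime factors of \<open>n\<close> are at most \<open>N\<close>, so two finite
  products cover them; at every other prime the factor is 1.\<close>

lemma prod_prime_factors_split:
  fixes g :: "nat \<Rightarrow> real"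
  assumes "0 < n" "n \<le> N"
  shows "(\<Prod>p\<in>prime_factors n. g p) =
    (\<Prod>p | p \<in> {..P} \<and> prime p. 1 + (g p - 1) * of_bool (p dvd n)) *
    (\<Prod>p | p \<in> {Suc P..N} \<and> prime p. 1 + (g p - 1) * of_bool (p dvd n))"
proof -
  have "(\<Prod>p | p \<in> {..P} \<and> prime p. 1 + (g p - 1) * of_bool (p dvd n)) *
        (\<Prod>p | p \<in> {Suc P..N} \<and> prime p. 1 + (g p - 1) * of_bool (p dvd n)) =
        (\<Prod>p\<in>{p \<in> {..P}. prime p} \<union> {p \<in> {Suc P..N}. prime p}. 1 + (g p - 1) * of_bool (p dvd n))"
    by (rule prod.union_disjoint[symmetric]) auto
  also have "\<dots> = (\<Prod>p\<in>prime_factors n. 1 + (g p - 1) * of_bool (p dvd n))"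
  proof (rule prod.mono_neutral_right)
    show "prime_factors n \<subseteq> {p \<in> {..P}. prime p} \<union> {p \<in> {Suc P..N}. prime p}"
      using assms by (auto simp: in_prime_factors_iff dest!: dvd_imp_le)
  qed (use assms in \<open>auto simp: in_prime_factors_iff\<close>)
  also have "\<dots> = (\<Prod>p\<in>prime_factors n. g p)"
    by (rule prod.cong) (auto simp: in_prime_factors_iff)
  finally show ?thesis by simp
qed

text \<open>For each \<open>n\<close> the error is at most the sum of \<open>1 - g p\<close> over
  the dropped primes \<open>p\<close> dividing \<open>n\<close>. Summed over \<open>n\<close>, such
  a prime has weight at most \<open>Suc a / p\<close> times the total, and
  \<open>1 - g p \<le> K / p\<close>, so the error is governed by the tail of the sum of
  \<open>1 / p^2\<close>.\<close>

lemma truncation_error: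
  fixes g :: "nat \<Rightarrow> real"
  assumes g: "\<And>p. prime p \<Longrightarrow> 0 \<le> g p" "\<And>p. prime p \<Longrightarrow> g p \<le> 1"
    and K: "\<And>p. prime p \<Longrightarrow> 1 - g p \<le> K / real p"
    and P: "P > 0"
  shows "\<bar>(\<Sum>n=1..N. real n ^ a * (\<Prod>p | p \<in> {..P} \<and> prime p. 1 + (g p - 1) * of_bool (p dvd n)))
            - (\<Sum>n=1..N. real n ^ a * (\<Prod>p\<in>prime_factors n. g p))\<bar>
         \<le> real (Suc a) * K / real P * (\<Sum>n=1..N. real n ^ a)"
proof -
  define A where "A = {p \<in> {..P}. prime p}"
  define B where "B = {p \<in> {Suc P..N}. prime p}"
  define F where "F S n = (\<Prod>p\<in>S. 1 + (g p - 1) * of_bool (p dvd n))" for S and n :: nat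
  define W where "W = (\<Sum>n=1..N. real n ^ a)"
  have "W \<ge> 0" unfolding W_def by (intro sum_nonneg) auto
  \<comment> \<open>The hypotheses at the prime 2 force this.\<close>
  have "K \<ge> 0" using K[of 2] g(2)[of 2] by simp
  have AB: "prime p" if "p \<in> A \<union> B" for p using that by (auto simp: A_def B_def)
  have diff: "\<bar>F A n - (\<Prod>p\<in>prime_factors n. g p)\<bar> \<le> (\<Sum>p\<in>B. (1 - g p) * of_bool (p dvd n))"
    if n: "n \<in> {1..N}" for n
  proof -
    have FA: "0 \<le> F A n" "F A n \<le> 1" unfolding F_def
      using AB g by (auto intro!: prod_nonneg prod_le_1 simp: of_bool_def)
    \<comment> \<open>Weierstrass' inequality: for numbers \<open>x\<close> in the unit interval,
      the product of the \<open>1 - x\<close> is at least 1 minus the sum of the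
      \<open>x\<close>.\<close>
    have "1 - (\<Sum>p\<in>B. (1 - g p) * of_bool (p dvd n)) \<le> (\<Prod>p\<in>B. 1 - (1 - g p) * of_bool (p dvd n))"
      using AB g by (intro Weierstrass_prod_ineq) (auto simp: of_bool_def)
    also have "\<dots> = F B n"
      unfolding F_def by (intro prod.cong) (auto simp: algebra_simps)
    finally have FB: "1 - F B n \<le> (\<Sum>p\<in>B. (1 - g p) * of_bool (p dvd n))" by simp
    have FB1: "F B n \<le> 1" unfolding F_def
      using AB g by (auto intro!: prod_le_1 simp: of_bool_def)
    have "(\<Prod>p\<in>prime_factors n. g p) = F A n * F B n"
      using n prod_prime_factors_split[of n N g P] by (simp add: F_def A_def B_def)
    then have "F A n - (\<Prod>p\<in>prime_factors n. g p) = F A n * (1 - F B n)"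
      by (simp add: algebra_simps)
    then have "\<bar>F A n - (\<Prod>p\<in>prime_factors n. g p)\<bar> = F A n * (1 - F B n)"
      using FA FB1 by simp
    also have "\<dots> \<le> 1 * (1 - F B n)"
      using FA FB1 by (intro mult_right_mono) auto
    finally show ?thesis using FB by simp
  qed
  have "\<bar>(\<Sum>n=1..N. real n ^ a * F A n) - (\<Sum>n=1..N. real n ^ a * (\<Prod>p\<in>prime_factors n. g p))\<bar>
      = \<bar>\<Sum>n=1..N. real n ^ a * (F A n - (\<Prod>p\<in>prime_factors n. g p))\<bar>"
    by (simp add: sum_subtractf right_diff_distrib)
  also have "\<dots> \<le> (\<Sum>n=1..N. \<bar>real n ^ a * (F A n - (\<Prod>p\<in>prime_factors n. g p))\<bar>)"
    by (rule sum_abs)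
  also have "\<dots> \<le> (\<Sum>n=1..N. real n ^ a * (\<Sum>p\<in>B. (1 - g p) * of_bool (p dvd n)))"
    unfolding abs_mult by (intro sum_mono mult_mono diff) auto
  also have "\<dots> = (\<Sum>p\<in>B. (1 - g p) * (\<Sum>n=1..N. real n ^ a * of_bool (p dvd n)))"
    unfolding sum_distrib_left by (subst sum.swap) (simp only: mult_ac)
  also have "\<dots> = (\<Sum>p\<in>B. (1 - g p) * (\<Sum>n | n \<in> {1..N} \<and> p dvd n. real n ^ a))"
    by (simp add: sum.inter_filter[symmetric] of_bool_def if_distrib cong: if_cong)
  also have "\<dots> \<le> (\<Sum>p\<in>B. K / real p * (real (Suc a) / real p * W))"
  proof (intro sum_mono mult_mono K)
    fix p assume "p \<in> B"
    then have p: "prime p" using AB by auto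
    show "prime p" by fact
    show "(\<Sum>n | n \<in> {1..N} \<and> p dvd n. real n ^ a) \<le> real (Suc a) / real p * W"
      unfolding W_def using prime_gt_0_nat[OF p] by (rule sum_powers_multiples_le)
  qed (use \<open>K \<ge> 0\<close> in \<open>auto intro!: sum_nonneg divide_nonneg_nonneg\<close>)
  also have "\<dots> = real (Suc a) * K * W * (\<Sum>p\<in>B. 1 / real p ^ 2)"
    by (simp add: sum_distrib_left power2_eq_square mult_ac)
  \<comment> \<open>Enlarge the primes in \<open>B\<close> to all integers between
    \<open>Suc P\<close> and \<open>N\<close>.\<close>
  also have "\<dots> \<le> real (Suc a) * K * W * (\<Sum>p=Suc P..N. 1 / real p ^ 2)"
    using \<open>K \<ge> 0\<close> \<open>W \<ge> 0\<close> by (intro mult_left_mono sum_mono2) (auto simp: B_def)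
  also have "\<dots> \<le> real (Suc a) * K * W * (1 / real P)"
    using \<open>K \<ge> 0\<close> \<open>W \<ge> 0\<close> by (intro mult_left_mono sum_inverse_squares_le P) auto
  finally show ?thesis
    by (simp add: F_def A_def W_def)
qed

lemma mean_value_prime_factors:
  fixes g :: "nat \<Rightarrow> real"
  assumes g: "\<And>p. prime p \<Longrightarrow> 0 \<le> g p" "\<And>p. prime p \<Longrightarrow> g p \<le> 1"
    and K: "\<And>p. prime p \<Longrightarrow> 1 - g p \<le> K / real p"
  shows "(\<lambda>N. (\<Sum>n=1..N. real n ^ a * (\<Prod>p\<in>prime_factors n. g p)) / (\<Sum>n=1..N. real n ^ a))
           \<longlonglongrightarrow> prime_prod (\<lambda>p. 1 - 1 / real p * (1 - g p))"
\<comment> \<open>Each fixed \<open>P\<close> has a limit in \<open>N\<close>; that the limit in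
  \<open>P\<close> is uniform in \<open>N\<close> lets the two be exchanged. Restricting to
  \<open>N > 0\<close> keeps the weight \<open>W N\<close> positive.\<close>
proof (rule swap_uniform_limit'[where F = sequentially and S = "{0<..}"])
  define W where "W N = (\<Sum>n=1..N. real n ^ a)" for N
  define R where "R P N = (\<Sum>n=1..N. real n ^ a *
      (\<Prod>p | p \<in> {..P} \<and> prime p. 1 + (g p - 1) * of_bool (p dvd n))) / W N" for P N
  show "\<forall>\<^sub>F P in sequentially. R P \<longlonglongrightarrow> (\<Prod>p | p \<in> {..P} \<and> prime p. 1 + (g p - 1) / real p)"
    unfolding R_def W_def by (intro always_eventually allI truncated_mean_value) auto
  have factor: "1 + (g p - 1) / real p = 1 - 1 / real p * (1 - g p)" for p
    by (simp add: diff_divide_distrib)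
  show "(\<lambda>P. \<Prod>p | p \<in> {..P} \<and> prime p. 1 + (g p - 1) / real p)
          \<longlonglongrightarrow> prime_prod (\<lambda>p. 1 - 1 / real p * (1 - g p))"
    unfolding factor by (rule prime_prod_tendsto(1)[OF assms])
  show "uniform_limit {0<..} R (\<lambda>N. (\<Sum>n=1..N. real n ^ a * (\<Prod>p\<in>prime_factors n. g p)) / (\<Sum>n=1..N. real n ^ a)) sequentially"
  proof (rule uniform_limitI)
    fix e :: real assume "e > 0"
    have "(\<lambda>P. real (Suc a) * K * (1 / real P)) \<longlonglongrightarrow> real (Suc a) * K * 0"
      by (intro tendsto_intros lim_1_over_n)
    then have "eventually (\<lambda>P. real (Suc a) * K * (1 / real P) < e) sequentially"
      using \<open>e > 0\<close> by (intro order_tendstoD(2)[where a = e]) auto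
    then show "\<forall>\<^sub>F P in sequentially. \<forall>N\<in>{0<..}. dist (R P N)
        ((\<Sum>n=1..N. real n ^ a * (\<Prod>p\<in>prime_factors n. g p)) / (\<Sum>n=1..N. real n ^ a)) < e"
      using eventually_gt_at_top[of 0]
    proof eventually_elim
      case (elim P)
      show ?case
      proof
        fix N :: nat assume "N \<in> {0<..}"
        then have "W N > 0" unfolding W_def by (intro sum_powers_pos) auto
        have "dist (R P N) ((\<Sum>n=1..N. real n ^ a * (\<Prod>p\<in>prime_factors n. g p)) / W N)
            \<le> (real (Suc a) * K / real P * W N) / W N"
          using truncation_error[OF assms elim(2), where N = N and a = a] \<open>W N > 0\<close>
          by (simp add: R_def dist_real_def W_def diff_divide_distrib[symmetric] pos_divide_le_eq)
        also have "\<dots> < e"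
          using elim(1) \<open>W N > 0\<close> by simp
        finally show "dist (R P N)
            ((\<Sum>n=1..N. real n ^ a * (\<Prod>p\<in>prime_factors n. g p)) / (\<Sum>n=1..N. real n ^ a)) < e"
          by (simp add: W_def)
      qed
    qed
  qed
qed (auto intro: eventually_gt_at_top)

text \<open>Interface to the counting part: the mean value is divided by its limit \<open>M\<close>,
  which is positive. Only \<open>x n\<close> for \<open>n > 0\<close> is prescribed, as the averages
  start at 1.\<close>

lemma cesaro_equivalent_prime_factors:
  fixes g :: "nat \<Rightarrow> real"
  assumes g: "\<And>p. prime p \<Longrightarrow> 0 \<le> g p" "\<And>p. prime p \<Longrightarrow> g p \<le> 1"
    and K: "\<And>p. prime p \<Longrightarrow> 1 - g p \<le> K / real p"
    and x: "\<And>n. n > 0 \<Longrightarrow> x n = real n ^ a * (\<Prod>p\<in>prime_factors n. g p)"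
  shows "cesaro_equivalent x (\<lambda>n. prime_prod (\<lambda>p. 1 - 1 / real p * (1 - g p)) * real n ^ a)"
proof -
  define M where "M = prime_prod (\<lambda>p. 1 - 1 / real p * (1 - g p))"
  have "M > 0" unfolding M_def using prime_prod_tendsto(2)[of g K] assms by simp
  have "(\<lambda>N. (\<Sum>n=1..N. real n ^ a * (\<Prod>p\<in>prime_factors n. g p)) / (\<Sum>n=1..N. real n ^ a) / M) \<longlonglongrightarrow> M / M"
    unfolding M_def[symmetric]
    by (intro tendsto_divide tendsto_const)
       (use mean_value_prime_factors[of g K a] assms \<open>M > 0\<close> in \<open>auto simp: M_def\<close>)
  moreover have "(\<Sum>n=1..N. x n) = (\<Sum>n=1..N. real n ^ a * (\<Prod>p\<in>prime_factors n. g p))" for N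
    by (intro sum.cong) (auto simp: x)
  ultimately show ?thesis
    using \<open>M > 0\<close> unfolding cesaro_equivalent_def M_def[symmetric]
    by (simp add: sum_distrib_left[symmetric] mult.commute)
qed

section \<open>Integer matrices modulo \<open>n\<close>\<close>

text \<open>
  Matrices over \<open>\<int>/n\<close> are represented by integer matrices with entries in \<open>{0..<n}\<close>. Column vectors
  are functions of which only the values on \<open>{..<k}\<close> matter.
\<close>

definition mod_mats :: "nat \<Rightarrow> nat \<Rightarrow> int mat set" where
  "mod_mats k n = {A \<in> carrier_mat k k. \<forall>i<k. \<forall>j<k. A $$ (i, j) \<in> {0..<int n}}"

text \<open>For \<open>a = 1\<close> these represent the special linear group; the other units
  \<open>a\<close> serve to assemble the general linear group.\<close>

definition det_mats :: "nat \<Rightarrow> nat \<Rightarrow> int \<Rightarrow> int mat set" where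
  "det_mats k n a = {A \<in> mod_mats k n. [det A = a] (mod int n)}"

definition col_mats :: "nat \<Rightarrow> nat \<Rightarrow> int \<Rightarrow> (nat \<Rightarrow> int) \<Rightarrow> int mat set" where
  "col_mats k n a v = {A \<in> det_mats k n a. \<forall>i<k. A $$ (i, 0) = v i}"

text \<open>For \<open>n > 0\<close> this says that the entries of \<open>v\<close> generate the
  unit ideal modulo \<open>n\<close>. Testing primes one at a time suits both the descent and
  inclusion-exclusion.\<close>

definition unimodular :: "nat \<Rightarrow> nat \<Rightarrow> (nat \<Rightarrow> int) \<Rightarrow> bool" where
  "unimodular k n v \<longleftrightarrow> (\<forall>p. prime p \<longrightarrow> p dvd n \<longrightarrow> (\<exists>i<k. \<not> int p dvd v i))"

lemma finite_mod_mats [simp]: "finite (mod_mats k n)"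
proof (rule finite_subset)
  show "mod_mats k n \<subseteq> mat k k ` (({..<k} \<times> {..<k}) \<rightarrow>\<^sub>E {0..<int n})"
  proof
    fix A assume A: "A \<in> mod_mats k n"
    then have "A = mat k k (restrict (\<lambda>ij. A $$ ij) ({..<k} \<times> {..<k}))"
      by (intro eq_matI) (auto simp: mod_mats_def)
    moreover have "restrict (\<lambda>ij. A $$ ij) ({..<k} \<times> {..<k}) \<in> ({..<k} \<times> {..<k}) \<rightarrow>\<^sub>E {0..<int n}"
      using A by (auto simp: mod_mats_def)
    ultimately show "A \<in> mat k k ` (({..<k} \<times> {..<k}) \<rightarrow>\<^sub>E {0..<int n})" by blast
  qed
qed (auto intro: finite_PiE)

lemma finite_det_mats [simp]: "finite (det_mats k n a)"
  by (simp add: det_mats_def)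

lemma finite_col_mats [simp]: "finite (col_mats k n a v)"
  by (simp add: col_mats_def)

section \<open>Row operations and first columns\<close>

text \<open>By the Leibniz formula the determinant is an integer polynomial in the entries.\<close>

lemma det_cong_mod:
  fixes A B :: "int mat"
  assumes "A \<in> carrier_mat k k" "B \<in> carrier_mat k k"
    and "\<And>i j. i < k \<Longrightarrow> j < k \<Longrightarrow> [A $$ (i, j) = B $$ (i, j)] (mod m)"
  shows "[det A = det B] (mod m)"
  unfolding det_def'[OF assms(1)] det_def'[OF assms(2)]
proof (intro cong_sum cong_mult cong_prod cong_refl assms(3))
  fix p i assume "p \<in> {p. p permutes {0..<k}}" "i \<in> {0..<k}"
  then show "i < k" "p i < k"
    using permutes_in_image[of p "{0..<k}" i] by auto
qed

lemma col_mats_cong: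
  "(\<And>i. i < k \<Longrightarrow> v i = w i) \<Longrightarrow> col_mats k n a v = col_mats k n a w"
  by (simp add: col_mats_def)

text \<open>Adding \<open>c\<close> times row \<open>j\<close> to row \<open>i\<close> and reducing
  modulo \<open>n\<close> keeps the determinant modulo \<open>n\<close>, changes the first column
  accordingly, and is undone by \<open>- c\<close>.\<close>

lemma card_col_mats_addrow:
  assumes ij: "i < k" "j < k" "i \<noteq> j" and v: "\<And>l. l < k \<Longrightarrow> v l \<in> {0..<int n}"
  shows "card (col_mats k n a (v(i := (c * v j + v i) mod int n))) = card (col_mats k n a v)"
proof -
  define f where "f c A = map_mat (\<lambda>x. x mod int n) (addrow c i j A)" for c A
  define w where "w = v(i := (c * v j + v i) mod int n)"
  have n: "n > 0" using v[of i] ij by auto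
  have carrier: "f c A \<in> mod_mats k n" if "A \<in> mod_mats k n" for c A
    using that n by (auto simp: mod_mats_def f_def)
  have det: "[det (f c A) = det A] (mod int n)" if "A \<in> mod_mats k n" for c A
  proof -
    have A: "A \<in> carrier_mat k k" using that by (simp add: mod_mats_def)
    then have "[det (f c A) = det (addrow c i j A)] (mod int n)"
      by (intro det_cong_mod[where k = k]) (auto simp: f_def cong_def)
    then show ?thesis using det_addrow[OF ij(2,3) A] by simp
  qed
  \<comment> \<open>The reduction between the two operations is harmless: modulo \<open>n\<close>
    the changes cancel, and the entries of \<open>A\<close> are already reduced.\<close>
  have inv: "f (- c) (f c A) = A" if "A \<in> mod_mats k n" for c A
  proof (rule eq_matI)
    fix r s assume rs: "r < dim_row A" "s < dim_col A"
    have A: "A \<in> carrier_mat k k" "\<And>i j. i < k \<Longrightarrow> j < k \<Longrightarrow> A $$ (i, j) mod int n = A $$ (i, j)"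
      using that by (auto simp: mod_mats_def)
    have "(c * x + y - c * (x mod m)) mod m = y mod m" for x y m :: int
    proof -
      have "c * x + y - c * (x mod m) = y + m * (c * (x div m))"
        by (simp add: minus_mult_div_eq_mod[symmetric] algebra_simps)
      then show ?thesis by (simp only: mod_mult_self2)
    qed
    then have "(- (c * (A $$ (j, s) mod int n)) + (c * A $$ (j, s) + A $$ (r, s)) mod int n) mod int n
        = A $$ (r, s) mod int n"
      by (simp add: mod_simps)
    then show "f (- c) (f c A) $$ (r, s) = A $$ (r, s)"
      using A rs ij by (auto simp: f_def)
  qed (auto simp: f_def)
  have inv': "f c (f (- c) A) = A" if "A \<in> mod_mats k n" for A
    using inv[OF that, of "- c"] by simp
  have "bij_betw (f c) (col_mats k n a v) (col_mats k n a w)"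
  proof (rule bij_betw_byWitness[where f' = "f (- c)"])
    show "f c ` col_mats k n a v \<subseteq> col_mats k n a w"
    proof (intro image_subsetI)
      fix A assume "A \<in> col_mats k n a v"
      then have A: "A \<in> mod_mats k n" "[det A = a] (mod int n)" "\<And>l. l < k \<Longrightarrow> A $$ (l, 0) = v l"
        by (auto simp: col_mats_def det_mats_def)
      moreover have "f c A $$ (l, 0) = w l" if "l < k" for l
        using A that ij v[OF that] by (auto simp: mod_mats_def f_def w_def)
      ultimately show "f c A \<in> col_mats k n a w"
        using carrier[of A c] det[of A c] cong_trans by (auto simp: col_mats_def det_mats_def)
    qed
    show "f (- c) ` col_mats k n a w \<subseteq> col_mats k n a v"
    proof (intro image_subsetI)
      fix A assume "A \<in> col_mats k n a w"
      then have A: "A \<in> mod_mats k n" "[det A = a] (mod int n)" "\<And>l. l < k \<Longrightarrow> A $$ (l, 0) = w l"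
        by (auto simp: col_mats_def det_mats_def)
      have "(- (c * v j) + (c * v j + v i) mod int n) mod int n = v i mod int n"
        by (simp add: mod_simps)
      then have "f (- c) A $$ (l, 0) = v l" if "l < k" for l
        using A that ij v[OF that] by (auto simp: mod_mats_def f_def w_def)
      then show "f (- c) A \<in> col_mats k n a v"
        using A carrier[of A "- c"] det[of A "- c"] cong_trans by (auto simp: col_mats_def det_mats_def)
    qed
  qed (auto simp: inv inv' col_mats_def det_mats_def)
  then show ?thesis
    unfolding w_def[symmetric] by (rule bij_betw_same_card[symmetric])
qed

text \<open>Two row operations connect the columns through \<open>v1\<close>: with \<open>h\<close>
  inverse to \<open>g\<close>, adding \<open>h\<close> times row \<open>i\<close> puts 1 in row
  \<open>j\<close>, and subtracting \<open>g\<close> times row \<open>j\<close> then clears row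
  \<open>i\<close>.\<close>

lemma card_col_mats_unit_multiple:
  assumes ij: "i < k" "j < k" "i \<noteq> j" and n: "n > 1"
    and g: "g \<in> {0..<int n}" "coprime g (int n)"
  shows "card (col_mats k n a (\<lambda>l. if l = i then g else 0)) = card (col_mats k n a (\<lambda>l. if l = j then 1 else 0))"
proof -
  obtain h where h: "[g * h = 1] (mod int n)"
    using cong_solve_coprime_int[OF g(2)] by blast
  define v1 :: "nat \<Rightarrow> int" where "v1 = (\<lambda>l. if l = i then g else if l = j then 1 else 0)"
  have "card (col_mats k n a ((\<lambda>l. if l = i then g else 0)
           (j := (h * (if i = i then g else 0) + (if j = i then g else 0)) mod int n)))
      = card (col_mats k n a (\<lambda>l. if l = i then g else 0))"
    using ij g by (intro card_col_mats_addrow) auto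
  also have "(\<lambda>l. if l = i then g else 0)
           (j := (h * (if i = i then g else 0) + (if j = i then g else 0)) mod int n) = v1"
    using ij h n by (auto simp: v1_def cong_def mult.commute)
  finally have 1: "card (col_mats k n a v1) = card (col_mats k n a (\<lambda>l. if l = i then g else 0))" .
  have "card (col_mats k n a (v1(i := (- g * v1 j + v1 i) mod int n))) = card (col_mats k n a v1)"
    using ij g n by (intro card_col_mats_addrow) (auto simp: v1_def)
  also have "v1(i := (- g * v1 j + v1 i) mod int n) = (\<lambda>l. if l = j then 1 else 0)"
    using ij by (auto simp: v1_def)
  finally show ?thesis using 1 by simp
qed

text \<open>Divisibility by a prime factor of \<open>n\<close> survives reduction modulo
  \<open>n\<close>, so such a prime dividing all new entries, among them \<open>v j\<close>, divides
  the old ones as well.\<close>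

lemma unimodular_addrow:
  assumes "unimodular k n v" "i < k" "j < k" "i \<noteq> j"
  shows "unimodular k n (v(i := (c * v j + v i) mod int n))"
  unfolding unimodular_def
proof (intro allI impI, rule ccontr)
  fix p assume p: "prime p" "p dvd n"
  assume "\<not> (\<exists>l<k. \<not> int p dvd (v(i := (c * v j + v i) mod int n)) l)"
  then have *: "\<And>l. l < k \<Longrightarrow> int p dvd (v(i := (c * v j + v i) mod int n)) l" by blast
  have "int p dvd v j" using *[of j] assms by simp
  moreover have "int p dvd c * v j + v i"
    using *[of i] assms p by (simp add: dvd_mod_iff)
  ultimately have "int p dvd v i"
    by (metis dvd_add_right_iff dvd_mult)
  then have "int p dvd v l" if "l < k" for l
    using *[OF that] by (cases "l = i") auto
  then show False
    using assms(1) p unfolding unimodular_def by blast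
qed

text \<open>
  A subtractive Euclidean algorithm on the entries leads to a single nonzero entry, a unit modulo
  \<open>n\<close>. The entry \<open>1 mod n\<close> of the target column differs from \<open>1\<close> only for \<open>n = 1\<close>.
\<close>

lemma card_col_mats_unimodular:
  assumes "unimodular k n v" "\<And>l. l < k \<Longrightarrow> v l \<in> {0..<int n}" "k > 1"
  shows "card (col_mats k n a v) = card (col_mats k n a (\<lambda>l. if l = 0 then 1 mod int n else 0))"
  using assms
proof (induction "\<Sum>l<k. nat (v l)" arbitrary: v rule: less_induct)
  case (less v)
  have n: "n > 0" using less.prems(2)[of 0] less.prems(3) by auto
  show ?case
  proof (cases "\<exists>i j. i < k \<and> j < k \<and> i \<noteq> j \<and> 0 < v j \<and> v j \<le> v i")
    case True
    then obtain i j where ij: "i < k" "j < k" "i \<noteq> j" "0 < v j" "v j \<le> v i" by blast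
    define w where "w = v(i := (- 1 * v j + v i) mod int n)"
    \<comment> \<open>As \<open>0 < v j \<le> v i < n\<close>, the subtraction does not wrap around,
      so the sum of the entries drops.\<close>
    have w: "w l = (if l = i then v i - v j else v l)" if "l < k" for l
      using ij less.prems(2)[of i] by (simp add: w_def)
    have "(\<Sum>l<k. nat (w l)) < (\<Sum>l<k. nat (v l))"
      using ij w by (intro sum_strict_mono_ex1) auto
    moreover have "unimodular k n w"
      unfolding w_def using less.prems ij by (intro unimodular_addrow) auto
    moreover have "w l \<in> {0..<int n}" if "l < k" for l
      using w[OF that] less.prems(2)[OF that] less.prems(2)[of i] ij by auto
    ultimately have "card (col_mats k n a w) = card (col_mats k n a (\<lambda>l. if l = 0 then 1 mod int n else 0))"
      using less.hyps less.prems(3) by blast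
    moreover have "card (col_mats k n a w) = card (col_mats k n a v)"
      unfolding w_def using less.prems ij by (intro card_col_mats_addrow) auto
    ultimately show ?thesis by simp
  next
    case False
    \<comment> \<open>Two nonzero entries would be comparable, so one could be subtracted from the
      other.\<close>
    have one: "i = j" if "i < k" "j < k" "v i \<noteq> 0" "v j \<noteq> 0" for i j
      using False that less.prems(2)[of i] less.prems(2)[of j] by (smt (verit) atLeastLessThan_iff)
    show ?thesis
    proof (cases "n = 1")
      \<comment> \<open>Modulo 1 every entry is 0, and so is \<open>1 mod int n\<close>.\<close>
      case True
      then show ?thesis
        using less.prems(2) by (intro arg_cong[where f = card] col_mats_cong) fastforce
    next
      case False
      then have n: "n > 1" using n by simp
      then obtain p where "prime p" "p dvd n" using prime_factor_nat[of n] by auto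
      then obtain i where i: "i < k" "v i \<noteq> 0"
        using less.prems(1) unfolding unimodular_def by (metis dvd_0_right)
      define g where "g = v i"
      have v: "v l = (if l = i then g else 0)" if "l < k" for l
        using one[OF that i(1) _ i(2)] by (auto simp: g_def)
      have g: "g \<in> {0..<int n}" using i less.prems(2) by (auto simp: g_def)
      \<comment> \<open>A common prime factor of \<open>g\<close> and \<open>n\<close> would divide
        all entries of \<open>v\<close>.\<close>
      have "coprime g (int n)"
      proof (rule ccontr)
        assume "\<not> coprime g (int n)"
        then have "gcd (nat g) n \<noteq> 1"
          using g by (metis atLeastLessThan_iff coprime_iff_gcd_eq_1 coprime_int_iff int_nat_eq)
        then obtain q where q: "prime q" "q dvd gcd (nat g) n"
          using prime_factor_nat by blast
        then have "q dvd nat g" by simp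
        then have "int q dvd int (nat g)"
          by (simp only: int_dvd_int_iff)
        also have "int (nat g) = g" using g by simp
        finally have "int q dvd g" .
        then have "\<forall>l<k. int q dvd v l" using v by auto
        then show False using q less.prems(1) unfolding unimodular_def by auto
      qed
      note move = card_col_mats_unit_multiple[OF _ _ _ n, where k = k and a = a]
      have "card (col_mats k n a v) = card (col_mats k n a (\<lambda>l. if l = i then g else 0))"
        using v by (intro arg_cong[where f = card] col_mats_cong) auto
      also have "\<dots> = card (col_mats k n a (\<lambda>l. if l = 0 then 1 else 0))"
      \<comment> \<open>The move needs two different rows, so for \<open>i = 0\<close> it makes a
        detour through row 1, available since \<open>k > 1\<close>.\<close>
      proof (cases "i = 0")
        case True
        have "card (col_mats k n a (\<lambda>l. if l = i then g else 0)) = card (col_mats k n a (\<lambda>l. if l = 1 then 1 else 0))"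
          using True i less.prems(3) g \<open>coprime g (int n)\<close> by (intro move) auto
        also have "\<dots> = card (col_mats k n a (\<lambda>l. if l = 0 then 1 else 0))"
          using less.prems(3) n by (intro move) auto
        finally show ?thesis .
      next
        case False
        then show ?thesis
          using i g \<open>coprime g (int n)\<close> by (intro move) auto
      qed
      also have "1 = 1 mod int n" using n by simp
      finally show ?thesis .
    qed
  qed
qed

section \<open>Recursion in the dimension\<close>

lemma det_unit_first_column:
  fixes A :: "int mat"
  assumes A: "A \<in> carrier_mat (Suc k) (Suc k)" and col: "\<And>i. i < Suc k \<Longrightarrow> A $$ (i, 0) = (if i = 0 then c else 0)"
  shows "det A = c * det (mat_delete A 0 0)"
proof -
  have "det A = (\<Sum>i<Suc k. A $$ (i, 0) * cofactor A i 0)"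
    by (rule laplace_expansion_column[OF A]) simp
  also have "\<dots> = (\<Sum>i<Suc k. if i = 0 then c * cofactor A 0 0 else 0)"
    using col by (intro sum.cong) auto
  also have "\<dots> = c * det (mat_delete A 0 0)"
    by (simp add: cofactor_def del: sum.lessThan_Suc)
  finally show ?thesis .
qed

text \<open>The rest of the top row is free, giving \<open>n ^ k\<close>, and expansion along the
  first column shows that the minor has the same determinant modulo \<open>n\<close>.\<close>

lemma card_col_mats_unit:
  assumes n: "n > 0"
  shows "card (col_mats (Suc k) n a (\<lambda>l. if l = 0 then 1 mod int n else 0)) = n ^ k * card (det_mats k n a)"
proof -
  define e where "e = (\<lambda>l::nat. if l = 0 then 1 mod int n else 0)"
  define R where "R = {..<k} \<rightarrow>\<^sub>E {0..<int n}"
  \<comment> \<open>\<open>f\<close> borders a smaller matrix by the column \<open>e\<close> and a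
    top row; \<open>g\<close> reads these data off again.\<close>
  define f :: "(nat \<Rightarrow> int) \<times> int mat \<Rightarrow> int mat" where "f = (\<lambda>(r, B). mat (Suc k) (Suc k)
     (\<lambda>(i, j). if j = 0 then e i else if i = 0 then r (j - 1) else B $$ (i - 1, j - 1)))"
  define g :: "int mat \<Rightarrow> (nat \<Rightarrow> int) \<times> int mat" where "g A = (restrict (\<lambda>j. A $$ (0, Suc j)) {..<k}, mat_delete A 0 0)" for A
  have det: "[det A = det (mat_delete A 0 0)] (mod int n)"
    if "A \<in> carrier_mat (Suc k) (Suc k)" "\<And>i. i < Suc k \<Longrightarrow> A $$ (i, 0) = e i" for A
  proof -
    have "det A = (1 mod int n) * det (mat_delete A 0 0)"
      using that by (intro det_unit_first_column[where k = k]) (auto simp: e_def)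
    also have "[\<dots> = 1 * det (mat_delete A 0 0)] (mod int n)"
      by (intro cong_mult cong_refl) (simp add: cong_def)
    finally show ?thesis by simp
  qed
  have fdel: "mat_delete (f (r, B)) 0 0 = B" if "B \<in> carrier_mat k k" for r B
    using that by (intro eq_matI) (auto simp: f_def mat_delete_def)
  have "bij_betw f (R \<times> det_mats k n a) (col_mats (Suc k) n a e)"
  proof (rule bij_betw_byWitness[where f' = g])
    show "\<forall>x\<in>R \<times> det_mats k n a. g (f x) = x"
    proof
      fix x assume "x \<in> R \<times> det_mats k n a"
      then obtain r B where x: "x = (r, B)" "r \<in> R" "B \<in> carrier_mat k k"
        by (auto simp: det_mats_def mod_mats_def)
      have "restrict (\<lambda>j. f (r, B) $$ (0, Suc j)) {..<k} = r"
        using x(2) by (auto simp: f_def R_def PiE_def extensional_def)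
      then show "g (f x) = x"
        using fdel[OF x(3)] by (simp add: g_def x(1))
    qed
    show "\<forall>A\<in>col_mats (Suc k) n a e. f (g A) = A"
    proof
      fix A assume "A \<in> col_mats (Suc k) n a e"
      then have A: "A \<in> carrier_mat (Suc k) (Suc k)" "\<And>i. i < Suc k \<Longrightarrow> A $$ (i, 0) = e i"
        by (auto simp: col_mats_def det_mats_def mod_mats_def)
      show "f (g A) = A"
      proof (rule eq_matI)
        fix i j assume "i < dim_row A" "j < dim_col A"
        then show "f (g A) $$ (i, j) = A $$ (i, j)"
          using A by (cases i; cases j) (auto simp: f_def g_def mat_delete_def)
      qed (use A in \<open>auto simp: f_def g_def\<close>)
    qed
    show "f ` (R \<times> det_mats k n a) \<subseteq> col_mats (Suc k) n a e"
    proof (intro image_subsetI)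
      fix x assume "x \<in> R \<times> det_mats k n a"
      then obtain r B where x: "x = (r, B)" "r \<in> R" "B \<in> mod_mats k n" "[det B = a] (mod int n)"
        by (auto simp: det_mats_def)
      have B: "B \<in> carrier_mat k k" using x(3) by (simp add: mod_mats_def)
      have "f x \<in> mod_mats (Suc k) n"
        using x n by (auto simp: f_def mod_mats_def R_def PiE_def Pi_def e_def)
      moreover have "f x $$ (i, 0) = e i" if "i < Suc k" for i
        using that by (simp add: f_def x(1))
      moreover from calculation have "[det (f x) = det B] (mod int n)"
        using det[of "f x"] fdel[OF B] by (auto simp: x(1) mod_mats_def)
      ultimately show "f x \<in> col_mats (Suc k) n a e"
        using x(4) cong_trans by (auto simp: col_mats_def det_mats_def)
    qed
    show "g ` col_mats (Suc k) n a e \<subseteq> R \<times> det_mats k n a"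
    proof (intro image_subsetI)
      fix A assume "A \<in> col_mats (Suc k) n a e"
      then have A: "A \<in> mod_mats (Suc k) n" "[det A = a] (mod int n)" "\<And>i. i < Suc k \<Longrightarrow> A $$ (i, 0) = e i"
        by (auto simp: col_mats_def det_mats_def)
      then have "[det (mat_delete A 0 0) = a] (mod int n)"
        using det[of A] cong_trans cong_sym by (metis (no_types, lifting) mem_Collect_eq mod_mats_def)
      then show "g A \<in> R \<times> det_mats k n a"
        using A(1) by (auto simp: g_def R_def det_mats_def mod_mats_def mat_delete_def)
    qed
  qed
  then have "card (col_mats (Suc k) n a e) = card (R \<times> det_mats k n a)"
    by (rule bij_betw_same_card[symmetric])
  then show ?thesis
    by (simp add: card_cartesian_product R_def card_PiE e_def)
qed

text \<open>A prime factor of \<open>n\<close> dividing the whole column divides the determinant by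
  Laplace expansion, hence also \<open>a\<close>, contrary to coprimality.\<close>

lemma col_mats_imp_unimodular:
  assumes "A \<in> col_mats k n a v" "coprime a (int n)" "k > 0"
  shows "unimodular k n v"
  unfolding unimodular_def
proof (intro allI impI, rule ccontr)
  fix p assume p: "prime p" "p dvd n" and "\<not> (\<exists>i<k. \<not> int p dvd v i)"
  then have v: "\<And>i. i < k \<Longrightarrow> int p dvd v i" by blast
  have A: "A \<in> carrier_mat k k" "[det A = a] (mod int n)" "\<And>i. i < k \<Longrightarrow> A $$ (i, 0) = v i"
    using assms(1) by (auto simp: col_mats_def det_mats_def mod_mats_def)
  have "int p dvd (\<Sum>i<k. A $$ (i, 0) * cofactor A i 0)"
    using A v by (intro dvd_sum dvd_mult2) auto
  then have "int p dvd det A"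
    using laplace_expansion_column[OF A(1) assms(3)] by simp
  moreover have "[det A = a] (mod int p)"
    using A(2) p(2) cong_dvd_modulus by (metis int_dvd_int_iff)
  ultimately have "int p dvd a" by (simp add: cong_dvd_iff)
  then have "is_unit (int p)"
    using assms(2) p(2) by (metis coprime_common_divisor int_dvd_int_iff)
  then show False using p(1) by (auto dest: prime_gt_1_nat)
qed

text \<open>Splitting by the first column: only unimodular columns occur, each as often as the first
  unit vector. With \<open>k > 0\<close> there are at least two rows, as the row operations
  require.\<close>

lemma card_det_mats_Suc:
  assumes "k > 0" "n > 0" "coprime a (int n)"
  shows "card (det_mats (Suc k) n a)
    = card {v \<in> {..<Suc k} \<rightarrow>\<^sub>E {0..<int n}. unimodular (Suc k) n v} * (n ^ k * card (det_mats k n a))"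
proof -
  define V where "V = {v \<in> {..<Suc k} \<rightarrow>\<^sub>E {0..<int n}. unimodular (Suc k) n v}"
  have fin: "finite V" unfolding V_def by (auto intro!: finite_PiE)
  have "det_mats (Suc k) n a = (\<Union>v\<in>V. col_mats (Suc k) n a v)"
  proof (intro equalityI subsetI)
    fix A assume A: "A \<in> det_mats (Suc k) n a"
    define v where "v = restrict (\<lambda>i. A $$ (i, 0)) {..<Suc k}"
    have "A \<in> col_mats (Suc k) n a v"
      using A by (auto simp: col_mats_def v_def)
    moreover have "v \<in> {..<Suc k} \<rightarrow>\<^sub>E {0..<int n}"
      using A by (auto simp: v_def det_mats_def mod_mats_def)
    ultimately show "A \<in> (\<Union>v\<in>V. col_mats (Suc k) n a v)"
      using col_mats_imp_unimodular assms by (auto simp: V_def)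
  qed (auto simp: col_mats_def)
  also have "card \<dots> = (\<Sum>v\<in>V. card (col_mats (Suc k) n a v))"
  proof (intro card_UN_disjoint fin ballI impI)
    fix v w assume vw: "v \<in> V" "w \<in> V" "v \<noteq> w"
    \<comment> \<open>Columns are extensional functions here, so two different ones differ at an
      index below \<open>Suc k\<close>.\<close>
    then obtain i where "i < Suc k" "v i \<noteq> w i"
      using PiE_ext[of v "{..<Suc k}" "\<lambda>_. {0..<int n}" w] unfolding V_def by blast
    then show "col_mats (Suc k) n a v \<inter> col_mats (Suc k) n a w = {}"
      by (auto simp: col_mats_def)
  qed simp
  also have "\<dots> = (\<Sum>v\<in>V. n ^ k * card (det_mats k n a))"
  proof (intro sum.cong refl)
    fix v assume "v \<in> V"
    then have "card (col_mats (Suc k) n a v) = card (col_mats (Suc k) n a (\<lambda>l. if l = 0 then 1 mod int n else 0))"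
      using assms(1) by (intro card_col_mats_unimodular) (auto simp: V_def PiE_def Pi_def)
    then show "card (col_mats (Suc k) n a v) = n ^ k * card (det_mats k n a)"
      using card_col_mats_unit[OF assms(2)] by simp
  qed
  finally show ?thesis by (simp add: V_def)
qed

section \<open>Counting unimodular columns\<close>

lemma card_multiples_below:
  assumes "D > 0" "D dvd n"
  shows "card {x \<in> {0..<int n}. int D dvd x} = n div D"
proof -
  have "bij_betw (\<lambda>m. int D * int m) {..<n div D} {x \<in> {0..<int n}. int D dvd x}"
  proof (rule bij_betwI[where g = "\<lambda>x. nat x div D"])
    show "(\<lambda>m. int D * int m) \<in> {..<n div D} \<rightarrow> {x \<in> {0..<int n}. int D dvd x}"
      using assms by (auto simp flip: of_nat_mult elim!: dvdE)
    show "(\<lambda>x. nat x div D) \<in> {x \<in> {0..<int n}. int D dvd x} \<rightarrow> {..<n div D}"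
    proof (intro funcsetI)
      fix x assume "x \<in> {x \<in> {0..<int n}. int D dvd x}"
      then have "0 \<le> x" "x < int n" "int D dvd x" by auto
      then obtain z where x: "x = int D * z" "0 \<le> x" "x < int n"
        unfolding dvd_def by blast
      then have "nat x = D * nat z"
        by (simp add: nat_mult_distrib)
      moreover have "nat x < n"
        using x by linarith
      ultimately show "nat x div D \<in> {..<n div D}"
        using assms unfolding dvd_def by auto
    qed
    show "int D * int (nat x div D) = x" if "x \<in> {x \<in> {0..<int n}. int D dvd x}" for x
    proof -
      have "0 \<le> x" "int D dvd x" using that by auto
      then have "x = int (nat x)" "D dvd nat x"
        by (simp_all flip: int_dvd_int_iff)
      then show ?thesis by (metis dvd_mult_div_cancel of_nat_mult)
    qed
  qed (use assms in \<open>simp add: nat_mult_distrib\<close>)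
  from bij_betw_same_card[OF this] show ?thesis by simp
qed

text \<open>The value is Jordan's totient of \<open>n\<close>, found by inclusion-exclusion over the
  squarefree divisors \<open>D\<close>: the columns with all entries divisible by \<open>D\<close>
  number \<open>(n div D) ^ k\<close>.\<close>

lemma card_unimodular:
  assumes n: "n > 0"
  shows "real (card {v \<in> {..<k} \<rightarrow>\<^sub>E {0..<int n}. unimodular k n v})
    = real n ^ k * (\<Prod>p\<in>prime_factors n. 1 - 1 / real p ^ k)"
proof -
  define X where "X = {..<k} \<rightarrow>\<^sub>E {0..<int n}"
  define S where "S = prime_factors n"
  \<comment> \<open>A prime divides all entries of \<open>v\<close> iff it divides \<open>d v\<close>, so the expansion over divisors applies.\<close>
  define d where "d v = nat (Gcd (v ` {..<k}))" for v :: "nat \<Rightarrow> int"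
  have d: "m dvd d v \<longleftrightarrow> (\<forall>i<k. int m dvd v i)" for m v
  proof -
    have "m dvd d v \<longleftrightarrow> int m dvd Gcd (v ` {..<k})"
      by (simp add: d_def flip: int_dvd_int_iff)
    then show ?thesis by (auto simp: dvd_Gcd_iff)
  qed
  have fin: "finite X" by (auto simp: X_def intro: finite_PiE)
  have S: "finite S" "\<And>p. p \<in> S \<Longrightarrow> prime p" by (auto simp: S_def)
  \<comment> \<open>The factor at \<open>p\<close> is 0 if \<open>p\<close> divides every entry and
    1 otherwise.\<close>
  have ind: "(\<Prod>p\<in>S. 1 + (- 1) * of_bool (p dvd d v)) = (of_bool (unimodular k n v) :: real)" for v
  proof (cases "unimodular k n v")
    case True
    then have "(\<Prod>p\<in>S. 1 + (- 1) * of_bool (p dvd d v)) = (\<Prod>p\<in>S. 1 :: real)"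
      by (intro prod.cong) (auto simp: S_def in_prime_factors_iff d unimodular_def)
    with True show ?thesis by simp
  next
    case False
    then obtain p where "prime p" "p dvd n" "p dvd d v" by (auto simp: unimodular_def d)
    then have "p \<in> S" "1 + (- 1) * of_bool (p dvd d v) = (0 :: real)"
      using n by (auto simp: S_def in_prime_factors_iff)
    then have "(\<Prod>p\<in>S. 1 + (- 1) * of_bool (p dvd d v)) = (0 :: real)"
      using S(1) by (intro prod_zero) auto
    with False show ?thesis by simp
  qed
  have count: "(\<Sum>v\<in>X. of_bool (\<Prod>T dvd d v)) = real n ^ k * (\<Prod>p\<in>T. 1 / real p ^ k)"
    if T: "T \<in> Pow S" for T
  proof -
    define D where "D = \<Prod>T"
    have finT: "finite T" using T S(1) by (auto intro: finite_subset)
    have "\<forall>p\<in>T. p > 0" using T S(2) by (auto dest: prime_gt_0_nat)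
    then have D0: "D > 0" unfolding D_def by (intro prod_pos) auto
    \<comment> \<open>A product of distinct prime factors of \<open>n\<close> divides
      \<open>n\<close>, which makes the count of multiples exact.\<close>
    have "D dvd n"
    proof -
      have "D dvd \<Prod>S" unfolding D_def using T S(1) by (intro prod_dvd_prod_subset) auto
      also have "\<Prod>S dvd (\<Prod>p\<in>S. p ^ multiplicity p n)"
        by (rule prod_dvd_prod)
          (use n in \<open>auto simp: S_def prime_factors_multiplicity intro!: dvd_power\<close>)
      also have "(\<Prod>p\<in>S. p ^ multiplicity p n) = n"
        unfolding S_def using n prime_factorization_nat[of n] by simp
      finally show ?thesis .
    qed
    have "(\<Sum>v\<in>X. of_bool (D dvd d v)) = real (card {v\<in>X. D dvd d v})"
      using fin by (simp add: sum.inter_filter[symmetric] of_bool_def)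
    also have "{v\<in>X. D dvd d v} = {..<k} \<rightarrow>\<^sub>E {x \<in> {0..<int n}. int D dvd x}"
      by (auto simp: X_def d PiE_def Pi_def)
    also have "real (card \<dots>) = real n ^ k * (1 / real D ^ k)"
      using card_multiples_below[OF D0 \<open>D dvd n\<close>] \<open>D dvd n\<close>
      by (simp add: card_PiE real_of_nat_div power_divide)
    also have "1 / real D ^ k = (\<Prod>p\<in>T. 1 / real p ^ k)"
      by (simp add: D_def prod_dividef prod_power_distrib)
    finally show ?thesis by (simp add: D_def)
  qed
  have "real (card {v\<in>X. unimodular k n v}) = (\<Sum>v\<in>X. of_bool (unimodular k n v))"
    using fin by (simp add: sum.inter_filter[symmetric] of_bool_def)
  also have "\<dots> = (\<Sum>v\<in>X. \<Sum>T\<in>Pow S. (\<Prod>p\<in>T. - 1) * of_bool (\<Prod>T dvd d v))"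
    unfolding ind[symmetric] using S by (subst prod_indicator_dvd_expansion) auto
  also have "\<dots> = (\<Sum>T\<in>Pow S. (\<Prod>p\<in>T. - 1) * (\<Sum>v\<in>X. of_bool (\<Prod>T dvd d v)))"
    by (subst sum.swap) (simp add: sum_distrib_left)
  also have "\<dots> = (\<Sum>T\<in>Pow S. (\<Prod>p\<in>T. - 1) * (real n ^ k * (\<Prod>p\<in>T. 1 / real p ^ k)))"
    by (intro sum.cong refl arg_cong2[where f = "(*)"] count)
  also have "\<dots> = real n ^ k * (\<Sum>T\<in>Pow S. (\<Prod>p\<in>T. (- 1) * (1 / real p ^ k)) * (\<Prod>p\<in>S - T. 1))"
    unfolding sum_distrib_left prod.distrib by (intro sum.cong) auto
  \<comment> \<open>The expansion is folded back with the indicators replaced by densities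
    \<open>1 / p ^ k\<close>.\<close>
  also have "(\<Sum>T\<in>Pow S. (\<Prod>p\<in>T. (- 1) * (1 / real p ^ k)) * (\<Prod>p\<in>S - T. 1)) = (\<Prod>p\<in>S. (- 1) * (1 / real p ^ k) + 1)"
    using S(1) by (rule prod_add[symmetric])
  finally show ?thesis by (simp add: X_def S_def)
qed

section \<open>Matrices of given determinant and of unit determinant\<close>

lemma card_det_mats_1:
  assumes "n > 0"
  shows "card (det_mats 1 n a) = 1"
proof -
  have "det_mats 1 n a = {mat 1 1 (\<lambda>_. a mod int n)}"
  proof (intro equalityI subsetI)
    fix A assume "A \<in> det_mats 1 n a"
    then have A: "A \<in> carrier_mat 1 1" "A $$ (0, 0) \<in> {0..<int n}" "[det A = a] (mod int n)"
      by (auto simp: det_mats_def mod_mats_def)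
    have "det A = A $$ (0, 0)"
      using laplace_expansion_column[OF A(1), of 0] A(1)
      by (simp add: cofactor_def mat_delete_def)
    then have "A $$ (0, 0) = a mod int n"
      using A(2,3) by (simp add: cong_def)
    then show "A \<in> {mat 1 1 (\<lambda>_. a mod int n)}"
      using A(1) by (auto intro!: eq_matI)
  next
    fix A assume A: "A \<in> {mat 1 1 (\<lambda>_. a mod int n)}"
    then have "A \<in> carrier_mat 1 1" by simp
    from laplace_expansion_column[OF this, of 0] have "det A = a mod int n"
      using A by (simp add: cofactor_def mat_delete_def)
    then show "A \<in> det_mats 1 n a"
      using A assms by (auto simp: det_mats_def mod_mats_def cong_def)
  qed
  then show ?thesis by simp
qed

text \<open>Passing from \<open>k\<close> to \<open>Suc k\<close> contributes Jordan's totient for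
  the first column and \<open>n ^ k\<close> for the top row. The one-dimensional count is 1, so the
  product starts at \<open>i = 2\<close>.\<close>

lemma card_det_mats:
  assumes "k > 0" "n > 0" "coprime a (int n)"
  shows "real (card (det_mats k n a)) = real n ^ (k ^ 2 - 1) * (\<Prod>p\<in>prime_factors n. \<Prod>i=2..k. 1 - 1 / real p ^ i)"
  using assms(1)
proof (induction k rule: nat_induct_non_zero)
  case 1
  then show ?case using card_det_mats_1[OF assms(2)] by simp
next
  case (Suc k)
  have "k ^ 2 \<ge> 1" using Suc.hyps by (simp add: power2_eq_square Suc_le_eq)
  \<comment> \<open>The three summands belong to the first column, the rest of the top row and the
    smaller matrix.\<close>
  then have exp: "Suc k ^ 2 - 1 = Suc k + (k + (k ^ 2 - 1))"
    by (simp add: power2_eq_square)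
  have "real (card (det_mats (Suc k) n a)) =
      (real n ^ Suc k * (\<Prod>p\<in>prime_factors n. 1 - 1 / real p ^ Suc k)) *
      (real n ^ k * (real n ^ (k ^ 2 - 1) * (\<Prod>p\<in>prime_factors n. \<Prod>i=2..k. 1 - 1 / real p ^ i)))"
    unfolding card_det_mats_Suc[OF Suc.hyps assms(2,3)] of_nat_mult
    by (simp add: card_unimodular[OF assms(2)] Suc.IH del: power_Suc)
  also have "\<dots> = real n ^ (Suc k ^ 2 - 1) *
      (\<Prod>p\<in>prime_factors n. (\<Prod>i=2..k. 1 - 1 / real p ^ i) * (1 - 1 / real p ^ Suc k))"
    unfolding exp power_add prod.distrib by simp
  also have "(\<Prod>p\<in>prime_factors n. (\<Prod>i=2..k. 1 - 1 / real p ^ i) * (1 - 1 / real p ^ Suc k))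
      = (\<Prod>p\<in>prime_factors n. \<Prod>i=2..Suc k. 1 - 1 / real p ^ i)"
    using Suc.hyps by simp
  finally show ?case .
qed

text \<open>\<open>totatives\<close> takes representatives from 1 to \<open>n\<close>; the class of
  \<open>n\<close> becomes 0, which is coprime to \<open>n\<close> only for
  \<open>n = 1\<close>.\<close>

lemma card_coprime_residues:
  assumes "n > 0"
  shows "card {a \<in> {0..<int n}. coprime a (int n)} = totient n"
proof -
  have "bij_betw (\<lambda>m. int (m mod n)) (totatives n) {a \<in> {0..<int n}. coprime a (int n)}"
  proof (rule bij_betwI[where g = "\<lambda>a. if a = 0 then n else nat a"])
    show "(\<lambda>m. int (m mod n)) \<in> totatives n \<rightarrow> {a \<in> {0..<int n}. coprime a (int n)}"
      using assms by (auto simp: totatives_def coprime_int_iff)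
    show "(\<lambda>a. if a = 0 then n else nat a) \<in> {a \<in> {0..<int n}. coprime a (int n)} \<rightarrow> totatives n"
    proof (intro funcsetI)
      fix a assume a: "a \<in> {a \<in> {0..<int n}. coprime a (int n)}"
      then have "coprime (nat a) n"
        using coprime_int_iff[of "nat a" n] by simp
      moreover have "n = 1" if "a = 0"
        using a that by simp
      ultimately show "(if a = 0 then n else nat a) \<in> totatives n"
        using a by (auto simp: totatives_def)
    qed
    show "int ((if a = 0 then n else nat a) mod n) = a" if "a \<in> {a \<in> {0..<int n}. coprime a (int n)}" for a
      using that by (auto simp: nat_less_iff)
    show "(if int (m mod n) = 0 then n else nat (int (m mod n))) = m" if "m \<in> totatives n" for m
      using that by (cases "m = n") (auto simp: totatives_def dest: nat_dvd_not_less)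
  qed
  from bij_betw_same_card[OF this] show ?thesis by (simp add: totient_def)
qed

text \<open>Representatives of the general linear group, as the adjugate argument will show.\<close>

definition unit_mats :: "nat \<Rightarrow> nat \<Rightarrow> int mat set" where
  "unit_mats k n = {A \<in> mod_mats k n. coprime (det A) (int n)}"

text \<open>Every unit determinant is attained equally often, so the count is multiplied by Euler's
  totient, whose product formula supplies both another power of \<open>n\<close> and the factor
  \<open>i = 1\<close>.\<close>

lemma card_unit_mats:
  assumes "k > 0" "n > 0"
  shows "real (card (unit_mats k n)) = real n ^ (k ^ 2) * (\<Prod>p\<in>prime_factors n. \<Prod>i=1..k. 1 - 1 / real p ^ i)"
proof -
  define U where "U = {a \<in> {0..<int n}. coprime a (int n)}"
  have finU: "finite U"
    unfolding U_def by (rule finite_subset[of _ "{0..<int n}"]) auto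
  have coprime_cong: "coprime x (int n) \<longleftrightarrow> coprime y (int n)" if "[x = y] (mod int n)" for x y
    using that cong_imp_coprime cong_sym by blast
  have "unit_mats k n = (\<Union>a\<in>U. det_mats k n a)"
  proof (intro equalityI subsetI)
    fix A assume A: "A \<in> unit_mats k n"
    have "[det A = det A mod int n] (mod int n)" by (simp add: cong_def)
    from A coprime_cong[OF this] have "coprime (det A mod int n) (int n)"
      by (simp add: unit_mats_def)
    then have "det A mod int n \<in> U" "A \<in> det_mats k n (det A mod int n)"
      using A assms by (simp_all add: unit_mats_def U_def det_mats_def cong_def)
    then show "A \<in> (\<Union>a\<in>U. det_mats k n a)" by blast
  next
    fix A assume "A \<in> (\<Union>a\<in>U. det_mats k n a)"
    then obtain a where a: "coprime a (int n)" "A \<in> mod_mats k n" "[det A = a] (mod int n)"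
      by (auto simp: U_def det_mats_def)
    from a(1,2) coprime_cong[OF a(3)] show "A \<in> unit_mats k n"
      by (simp add: unit_mats_def)
  qed
  also have "card \<dots> = (\<Sum>a\<in>U. card (det_mats k n a))"
  proof (intro card_UN_disjoint ballI impI)
    fix a b assume "a \<in> U" "b \<in> U" "a \<noteq> b"
    then have "\<not> [a = b] (mod int n)"
      by (auto simp: U_def cong_def)
    then show "det_mats k n a \<inter> det_mats k n b = {}"
      by (auto simp: det_mats_def cong_def)
  qed (simp_all add: finU)
  finally have "real (card (unit_mats k n)) = (\<Sum>a\<in>U. real (card (det_mats k n a)))" by simp
  also have "\<dots> = real (totient n) * (real n ^ (k ^ 2 - 1) * (\<Prod>p\<in>prime_factors n. \<Prod>i=2..k. 1 - 1 / real p ^ i))"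
    using assms card_coprime_residues[of n] by (simp add: U_def card_det_mats)
  also have "\<dots> = real n ^ Suc (k ^ 2 - 1) * (\<Prod>p\<in>prime_factors n. (1 - 1 / real p) * (\<Prod>i=2..k. 1 - 1 / real p ^ i))"
    by (simp add: totient_formula2 prod.distrib)
  also have "Suc (k ^ 2 - 1) = k ^ 2" using assms by simp
  also have "(\<Prod>p\<in>prime_factors n. (1 - 1 / real p) * (\<Prod>i=2..k. 1 - 1 / real p ^ i))
      = (\<Prod>p\<in>prime_factors n. \<Prod>i=1..k. 1 - 1 / real p ^ i)"
    using assms by (subst prod.atLeast_Suc_atMost[of 1 k]) (auto simp: numeral_2_eq_2)
  finally show ?thesis .
qed

section \<open>Matrices over the quotient ring\<close>

lemma ZMod_hom: "ring_hom_cring \<Z> (ZFact m) (ZMod m)"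
proof -
  interpret I: ideal "Idl\<^bsub>\<Z>\<^esub> {m}" \<Z>
    by (rule int.genideal_ideal) simp
  have "ring_hom_cring \<Z> (ZFact m) ((+>\<^bsub>\<Z>\<^esub>) (Idl\<^bsub>\<Z>\<^esub> {m}))"
    unfolding ZFact_def by (rule I.rcos_ring_hom_cring[OF int_is_cring])
  moreover have "(+>\<^bsub>\<Z>\<^esub>) (Idl\<^bsub>\<Z>\<^esub> {m}) = ZMod m"
    by (simp add: fun_eq_iff ZMod_def)
  ultimately show ?thesis by simp
qed

lemma carrier_ZFact: "carrier (ZFact m) = range (ZMod m)"
  by (auto simp: ZFact_defs A_RCOSETS_def' ZMod_def)

lemma ZMod_zero: "\<zero>\<^bsub>ZFact m\<^esub> = ZMod m 0"
  and ZMod_one: "\<one>\<^bsub>ZFact m\<^esub> = ZMod m 1"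
  and ZMod_add: "ZMod m a \<oplus>\<^bsub>ZFact m\<^esub> ZMod m b = ZMod m (a + b)"
  and ZMod_mult: "ZMod m a \<otimes>\<^bsub>ZFact m\<^esub> ZMod m b = ZMod m (a * b)"
  and ZMod_minus: "\<ominus>\<^bsub>ZFact m\<^esub> ZMod m a = ZMod m (- a)"
proof -
  interpret h: ring_hom_cring \<Z> "ZFact m" "ZMod m" by (rule ZMod_hom)
  show "\<zero>\<^bsub>ZFact m\<^esub> = ZMod m 0" "\<one>\<^bsub>ZFact m\<^esub> = ZMod m 1"
    "ZMod m a \<oplus>\<^bsub>ZFact m\<^esub> ZMod m b = ZMod m (a + b)"
    "ZMod m a \<otimes>\<^bsub>ZFact m\<^esub> ZMod m b = ZMod m (a * b)"
    "\<ominus>\<^bsub>ZFact m\<^esub> ZMod m a = ZMod m (- a)"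
    using h.hom_zero h.hom_one h.hom_add[of a b] h.hom_mult[of a b] h.hom_a_inv[of a]
    by (simp_all add: int_a_inv_eq)
qed

lemma ZMod_sum: "(\<Oplus>\<^bsub>ZFact m\<^esub>x\<in>S. ZMod m (f x)) = ZMod m (\<Sum>x\<in>S. f x)"
proof -
  interpret cring "ZFact m" by (rule ZFact_is_cring)
  show ?thesis
    \<comment> \<open>For infinite \<open>S\<close> both sums take the default value zero.\<close>
    by (induction S rule: infinite_finite_induct)
       (auto simp: ZMod_zero ZMod_add carrier_ZFact)
qed

lemma ZMod_prod: "(\<Otimes>\<^bsub>ZFact m\<^esub>x\<in>S. ZMod m (f x)) = ZMod m (\<Prod>x\<in>S. f x)"
proof -
  interpret cring "ZFact m" by (rule ZFact_is_cring)
  show ?thesis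
    by (induction S rule: infinite_finite_induct)
       (auto simp: ZMod_one ZMod_mult carrier_ZFact)
qed

text \<open>Both determinants are Leibniz sums, so the homomorphism carries one to the other; the
  parity test in \<open>ring_det\<close> becomes the integer \<open>sign\<close>.\<close>

lemma ring_det_ZMod:
  assumes "A \<in> carrier_mat k k"
  shows "ring_det k (ZFact m) (map_mat (ZMod m) A) = ZMod m (det A)"
proof -
  interpret cring "ZFact m" by (rule ZFact_is_cring)
  have entry: "(\<Otimes>\<^bsub>ZFact m\<^esub>i\<in>{0..<k}. map_mat (ZMod m) A $$ (i, \<sigma> i)) = ZMod m (\<Prod>i\<in>{0..<k}. A $$ (i, \<sigma> i))"
    if "\<sigma> permutes {0..<k}" for \<sigma>
  proof -
    have "\<sigma> i < k" if "i < k" for i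
      using permutes_in_image[OF \<open>\<sigma> permutes {0..<k}\<close>, of i] that by auto
    then show ?thesis
      unfolding ZMod_prod[symmetric] using assms
      by (intro finprod_cong') (auto simp: carrier_ZFact)
  qed
  have "ring_det k (ZFact m) (map_mat (ZMod m) A)
      = (\<Oplus>\<^bsub>ZFact m\<^esub>\<sigma>\<in>{\<sigma>. \<sigma> permutes {0..<k}}. ZMod m (sign \<sigma> * (\<Prod>i\<in>{0..<k}. A $$ (i, \<sigma> i))))"
    unfolding ring_det_def
    by (intro add.finprod_cong') (auto simp: entry ZMod_one ZMod_minus ZMod_mult carrier_ZFact sign_def)
  also have "\<dots> = ZMod m (det A)"
    unfolding ZMod_sum det_def'[OF assms] by simp
  finally show ?thesis .
qed

lemma mat_monoid_mult_ZMod: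
  assumes "A \<in> carrier_mat k k" "B \<in> carrier_mat k k"
  shows "map_mat (ZMod m) A \<otimes>\<^bsub>mat_monoid k (ZFact m)\<^esub> map_mat (ZMod m) B = map_mat (ZMod m) (A * B)"
proof -
  interpret cring "ZFact m" by (rule ZFact_is_cring)
  show ?thesis
    unfolding mat_monoid_def monoid.simps
  proof (rule eq_matI)
    fix i j assume "i < dim_row (map_mat (ZMod m) (A * B))" "j < dim_col (map_mat (ZMod m) (A * B))"
    then have ij: "i < k" "j < k" using assms by auto
    have "(\<Oplus>\<^bsub>ZFact m\<^esub>l\<in>{0..<k}. map_mat (ZMod m) A $$ (i, l) \<otimes>\<^bsub>ZFact m\<^esub> map_mat (ZMod m) B $$ (l, j))
        = (\<Oplus>\<^bsub>ZFact m\<^esub>l\<in>{0..<k}. ZMod m (A $$ (i, l) * B $$ (l, j)))"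
      using assms ij by (intro add.finprod_cong') (auto simp: ZMod_mult carrier_ZFact)
    also have "\<dots> = ZMod m ((A * B) $$ (i, j))"
      using assms ij by (simp add: ZMod_sum scalar_prod_def)
    finally show "mat k k (\<lambda>(i, j). \<Oplus>\<^bsub>ZFact m\<^esub>l\<in>{0..<k}. map_mat (ZMod m) A $$ (i, l) \<otimes>\<^bsub>ZFact m\<^esub>
        map_mat (ZMod m) B $$ (l, j)) $$ (i, j) = map_mat (ZMod m) (A * B) $$ (i, j)"
      using assms ij by simp
  qed (use assms in auto)
qed

lemma mat_monoid_one_ZMod: "\<one>\<^bsub>mat_monoid k (ZFact m)\<^esub> = map_mat (ZMod m) (1\<^sub>m k)"
  by (intro eq_matI) (auto simp: mat_monoid_def ZMod_zero ZMod_one)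

lemma map_mat_ZMod_eq_iff:
  assumes "A \<in> carrier_mat k k" "B \<in> carrier_mat k k"
  shows "map_mat (ZMod m) A = map_mat (ZMod m) B \<longleftrightarrow> (\<forall>i<k. \<forall>j<k. [A $$ (i, j) = B $$ (i, j)] (mod m))"
  using assms by (auto simp: mat_eq_iff ZMod_eq_mod cong_def)

lemma carrier_mat_monoid_ZFact:
  assumes "n > 0"
  shows "carrier (mat_monoid k (ZFact (int n))) = map_mat (ZMod (int n)) ` mod_mats k n"
proof (intro equalityI subsetI)
  fix X assume "X \<in> carrier (mat_monoid k (ZFact (int n)))"
  then have X: "X \<in> carrier_mat k k" "elements_mat X \<subseteq> range (ZMod (int n))"
    by (auto simp: mat_monoid_def carrier_ZFact)
  \<comment> \<open>Choose any preimage of each entry and reduce it to the standard range.\<close>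
  define A where "A = map_mat (\<lambda>x. inv_into UNIV (ZMod (int n)) x mod int n) X"
  have "X = map_mat (ZMod (int n)) A"
  proof (rule eq_matI)
    fix i j assume "i < dim_row (map_mat (ZMod (int n)) A)" "j < dim_col (map_mat (ZMod (int n)) A)"
    then have "i < k" "j < k" using X by (auto simp: A_def)
    then have "X $$ (i, j) \<in> range (ZMod (int n))" using X by (blast intro: elements_matI)
    then show "X $$ (i, j) = map_mat (ZMod (int n)) A $$ (i, j)"
      using X \<open>i < k\<close> \<open>j < k\<close> by (simp add: A_def ZMod_mod[symmetric] f_inv_into_f)
  qed (auto simp: A_def)
  moreover have "A \<in> mod_mats k n"
    using X assms by (auto simp: A_def mod_mats_def)
  ultimately show "X \<in> map_mat (ZMod (int n)) ` mod_mats k n" by blast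
qed (auto simp: mat_monoid_def mod_mats_def carrier_ZFact)

lemma inj_on_map_mat_ZMod: "inj_on (map_mat (ZMod (int n))) (mod_mats k n)"
proof (rule inj_onI)
  fix A B assume AB: "A \<in> mod_mats k n" "B \<in> mod_mats k n" and eq: "map_mat (ZMod (int n)) A = map_mat (ZMod (int n)) B"
  then have "A $$ (i, j) = B $$ (i, j)" if "i < k" "j < k" for i j
    using that map_mat_ZMod_eq_iff[of A k B "int n"] by (auto simp: mod_mats_def cong_def)
  then show "A = B" using AB by (intro eq_matI) (auto simp: mod_mats_def)
qed

lemma det_mats_subset: "det_mats k n a \<subseteq> mod_mats k n"
  by (auto simp: det_mats_def)

lemma unit_mats_subset: "unit_mats k n \<subseteq> mod_mats k n"
  by (auto simp: unit_mats_def)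

section \<open>The matrix groups over the quotient ring\<close>

lemma card_SL_ZFact:
  assumes "n > 0"
  shows "card (SL k (ZFact (int n))) = card (det_mats k n 1)"
proof -
  have "ring_det k (ZFact (int n)) (map_mat (ZMod (int n)) A) = \<one>\<^bsub>ZFact (int n)\<^esub> \<longleftrightarrow> [det A = 1] (mod int n)"
    if "A \<in> mod_mats k n" for A
    using that ring_det_ZMod[of A k "int n"] by (simp add: mod_mats_def ZMod_one ZMod_eq_mod cong_def)
  then have "SL k (ZFact (int n)) = map_mat (ZMod (int n)) ` det_mats k n 1"
    unfolding SL_def carrier_mat_monoid_ZFact[OF assms] det_mats_def by auto
  then show ?thesis
    using inj_on_subset[OF inj_on_map_mat_ZMod det_mats_subset] by (simp add: card_image)
qed

text \<open>Multiplicativity of the determinant gives one direction, the adjugate scaled by an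
  inverse of the determinant the other.\<close>

lemma map_mat_ZMod_in_Units_iff:
  assumes "A \<in> mod_mats k n" "n > 0"
  shows "map_mat (ZMod (int n)) A \<in> Units (mat_monoid k (ZFact (int n))) \<longleftrightarrow> coprime (det A) (int n)"
proof
  let ?h = "map_mat (ZMod (int n))"
  have A: "A \<in> carrier_mat k k" using assms by (simp add: mod_mats_def)
  {
    assume "?h A \<in> Units (mat_monoid k (ZFact (int n)))"
    then obtain B where B: "B \<in> mod_mats k n"
      "?h A \<otimes>\<^bsub>mat_monoid k (ZFact (int n))\<^esub> ?h B = \<one>\<^bsub>mat_monoid k (ZFact (int n))\<^esub>"
      by (auto simp: Units_def carrier_mat_monoid_ZFact[OF assms(2)])
    then have B': "B \<in> carrier_mat k k" by (simp add: mod_mats_def)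
    have "?h (A * B) = ?h (1\<^sub>m k)"
      using B(2) A B' by (simp add: mat_monoid_mult_ZMod mat_monoid_one_ZMod)
    then have "[det (A * B) = det (1\<^sub>m k)] (mod int n)"
      using A B' map_mat_ZMod_eq_iff[of "A * B" k "1\<^sub>m k" "int n"] by (intro det_cong_mod[where k = k]) auto
    then have "[det A * det B = 1] (mod int n)"
      using det_mult[OF A B'] by simp
    then show "coprime (det A) (int n)"
      using coprime_iff_invertible_int by blast
  next
    assume "coprime (det A) (int n)"
    then obtain h where h: "[det A * h = 1] (mod int n)"
      using cong_solve_coprime_int by blast
    \<comment> \<open>\<open>B\<close> has reduced entries and so lies in \<open>mod_mats\<close>;
      \<open>B'\<close> is its unreduced form, to which the adjugate identities apply.\<close>
    define B where "B = map_mat (\<lambda>x. (h * x) mod int n) (adj_mat A)"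
    define B' where "B' = h \<cdot>\<^sub>m adj_mat A"
    note adj = adj_mat[OF A]
    have BB': "?h B = ?h B'"
      using adj(1) by (intro eq_matI) (auto simp: B_def B'_def ZMod_mod[symmetric])
    have carrier: "B' \<in> carrier_mat k k" using adj(1) by (simp add: B'_def)
    have "B \<in> mod_mats k n"
      using adj(1) assms(2) by (auto simp: B_def mod_mats_def)
    moreover have "A * B' = (h * det A) \<cdot>\<^sub>m 1\<^sub>m k" "B' * A = (h * det A) \<cdot>\<^sub>m 1\<^sub>m k"
      unfolding B'_def mult_smult_distrib[OF A adj(1)] mult_smult_assoc_mat[OF adj(1) A] adj(2,3)
      by (auto intro!: eq_matI)
    moreover have "?h ((h * det A) \<cdot>\<^sub>m 1\<^sub>m k) = ?h (1\<^sub>m k)"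
      using h by (subst map_mat_ZMod_eq_iff[where k = k]) (auto simp: mult.commute)
    ultimately show "?h A \<in> Units (mat_monoid k (ZFact (int n)))"
      unfolding Units_def carrier_mat_monoid_ZFact[OF assms(2)]
      using assms(1) A carrier BB'
      by (auto simp: mat_monoid_mult_ZMod mat_monoid_one_ZMod intro!: bexI[of _ B] rev_image_eqI)
  }
qed

lemma card_GL_ZFact:
  assumes "n > 0"
  shows "card (GL k (ZFact (int n))) = card (unit_mats k n)"
proof -
  have "GL k (ZFact (int n)) = map_mat (ZMod (int n)) ` unit_mats k n"
  proof (intro equalityI subsetI)
    fix X assume X: "X \<in> GL k (ZFact (int n))"
    then have "X \<in> map_mat (ZMod (int n)) ` mod_mats k n"
      using carrier_mat_monoid_ZFact[OF assms] by (auto simp: GL_def Units_def)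
    with X show "X \<in> map_mat (ZMod (int n)) ` unit_mats k n"
      using assms by (auto simp: GL_def unit_mats_def map_mat_ZMod_in_Units_iff)
  qed (use assms in \<open>auto simp: GL_def unit_mats_def map_mat_ZMod_in_Units_iff\<close>)
  then show ?thesis
    using inj_on_subset[OF inj_on_map_mat_ZMod unit_mats_subset] by (simp add: card_image)
qed

section \<open>Euler factors and conclusion\<close>

text \<open>The hypotheses of the averaging result, for \<open>j = 2\<close> in the special and
  \<open>j = 1\<close> in the general linear case. At most \<open>Suc k\<close> indices occur, and
  \<open>1 / p ^ i \<le> 1 / p\<close> for each of them as \<open>i > 0\<close>.\<close>

lemma euler_factor_bounds:
  assumes "prime p" "j > 0"
  shows "0 \<le> (\<Prod>i=j..k. 1 - 1 / real p ^ i)" "(\<Prod>i=j..k. 1 - 1 / real p ^ i) \<le> 1"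
    and "1 - (\<Prod>i=j..k. 1 - 1 / real p ^ i) \<le> real (Suc k) / real p"
proof -
  have p: "real p \<ge> 1" using prime_ge_1_nat[OF assms(1)] by simp
  have *: "1 / real p ^ i \<in> {0..1}" for i
    using p by simp
  then show "0 \<le> (\<Prod>i=j..k. 1 - 1 / real p ^ i)" "(\<Prod>i=j..k. 1 - 1 / real p ^ i) \<le> 1"
    by (auto intro!: prod_nonneg prod_le_1)
  have "1 - (\<Sum>i=j..k. 1 / real p ^ i) \<le> (\<Prod>i=j..k. 1 - 1 / real p ^ i)"
    using * by (intro Weierstrass_prod_ineq)
  then have "1 - (\<Prod>i=j..k. 1 - 1 / real p ^ i) \<le> (\<Sum>i=j..k. 1 / real p ^ i)" by simp
  also have "\<dots> \<le> (\<Sum>i=j..k. 1 / real p)"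
    using assms(2) p self_le_power[of "real p"] by (intro sum_mono divide_left_mono) auto
  also have "\<dots> \<le> real (Suc k) / real p"
    by (auto intro!: divide_right_mono)
  finally show "1 - (\<Prod>i=j..k. 1 - 1 / real p ^ i) \<le> real (Suc k) / real p" .
qed

theorem theorem1:
  fixes k :: nat
  assumes "k > 0"
  shows "cesaro_equivalent (\<lambda>n. real (card (SL k (ZFact (int n)))))
                           (\<lambda>n. C1 k * real n ^ (k ^ 2 - 1))
       \<and> cesaro_equivalent (\<lambda>n. real (card (GL k (ZFact (int n)))))
                           (\<lambda>n. C2 k * real n ^ (k ^ 2))"
proof -
  \<comment> \<open>For \<open>k = 1\<close> the inner product is empty, so every Euler factor is 1,
    in agreement with the separate value.\<close>
  have C1: "C1 k = prime_prod (\<lambda>p. 1 - 1 / real p * (1 - (\<Prod>i=2..k. 1 - 1 / real p ^ i)))"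
    using assms by (simp add: C1_def prime_prod_def cong: if_cong)
  \<comment> \<open>For \<open>k = 1\<close> the general formula reduces to the factors
    \<open>1 - 1 / p^2\<close> of the separate case.\<close>
  have C2: "C2 k = prime_prod (\<lambda>p. 1 - 1 / real p * (1 - (\<Prod>i=1..k. 1 - 1 / real p ^ i)))"
    by (simp add: C2_def power2_eq_square)
  show ?thesis
    unfolding C1 C2
  proof
    show "cesaro_equivalent (\<lambda>n. real (card (SL k (ZFact (int n)))))
        (\<lambda>n. prime_prod (\<lambda>p. 1 - 1 / real p * (1 - (\<Prod>i=2..k. 1 - 1 / real p ^ i))) * real n ^ (k ^ 2 - 1))"
      by (rule cesaro_equivalent_prime_factors[where K = "real (Suc k)"])
         (use assms in \<open>auto intro: euler_factor_bounds simp: card_SL_ZFact card_det_mats simp del: of_nat_Suc\<close>)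
    show "cesaro_equivalent (\<lambda>n. real (card (GL k (ZFact (int n)))))
        (\<lambda>n. prime_prod (\<lambda>p. 1 - 1 / real p * (1 - (\<Prod>i=1..k. 1 - 1 / real p ^ i))) * real n ^ (k ^ 2))"
      by (rule cesaro_equivalent_prime_factors[where K = "real (Suc k)"])
         (use assms in \<open>auto intro: euler_factor_bounds simp: card_GL_ZFact card_unit_mats simp del: of_nat_Suc\<close>)
  qed
qed

end
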